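(* Let $c>0$ and let $S$ be the operator $Sf=\frac12Af+\int_{-c}^{c}k(y-x)f(y)\,dy$ on the segment $[-c,c]$. Suppose there exist functions $N_1,N_2\in L^{p_0}(-c,c)$, for some $p_0>1$, satisfying $$SN_k=x^{k-1},\quad k=1,2,\qquad\text{and}\qquad r=\int_{-c}^{c}N_1(x)\,dx\ne0.$$ Let $B$ be the corresponding operator $$Bf=\int_{-c}^{c}\Phi(x,y,c)f(y)\,dy,$$ where $$\Phi(x,y,c)=\frac12\int_{x+y}^{2c-|x-y|}q\Bigl[\frac{s+x-y}{2},\frac{s-x+y}{2}\Bigr]ds,\qquad q(x,y)=\frac{N_1(-y)N_2(x)-N_2(-y)N_1(x)}{r}.$$ Then $B$ is compact in all the spaces $L^{p}(-c,c)$, $p\ge1$.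
   Context: The operator $S$ comes from the convolution type form $Lf=\frac{d}{dx}S\frac{d}{dx}f$, $Sf=\frac12Af+\int_{-\infty}^{\infty}k(y-x)f(y)\,dy$, of the generator $L$ of a Lévy process, with $A\ge0$ and $\int_{-M}^{M}|k(t)|\,dt<\infty$ for every $0<M<\infty$; on functions on $[-c,c]$ it acts as displayed in the claim. The operator $B$ above is then the quasi-potential for $\Delta=[-c,c]$ (an operator with $-L_\Delta Bg=g$, where $L_\Delta$ is $L$ applied to functions extended by zero outside $\Delta$ and then restricted to $\Delta$). *)

theory Defs
  imports "HOL-Analysis.Analysis"
begin

text \<open>
  The scalars form a type of sort \<open>{real_normed_field, euclidean_space}\<close>, which has
  \<^typ>\<open>real\<close> and \<^typ>\<open>complex\<close> as instances, so that real and complex \<open>L\<^sup>p\<close> spaces are covered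
  simultaneously.
\<close>

section \<open>The spaces \<open>L\<^sup>p\<close> for real \<open>p \<ge> 1\<close>\<close>

definition Lp_fun ::
  "'m measure \<Rightarrow> real \<Rightarrow> ('m \<Rightarrow> 'a::{real_normed_field, euclidean_space}) set" where
  "Lp_fun M p = {f \<in> borel_measurable M. integrable M (\<lambda>x. norm (f x) powr p)}"

definition Lp_norm ::
  "'m measure \<Rightarrow> real \<Rightarrow> ('m \<Rightarrow> 'a::{real_normed_field, euclidean_space}) \<Rightarrow> real" where
  "Lp_norm M p f = (LINT x|M. norm (f x) powr p) powr (1 / p)"

definition Lp_rel ::
  "'m measure \<Rightarrow> real \<Rightarrow>
    (('m \<Rightarrow> 'a::{real_normed_field, euclidean_space}) \<times> ('m \<Rightarrow> 'a)) set" where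
  "Lp_rel M p = {(f, g). f \<in> Lp_fun M p \<and> g \<in> Lp_fun M p \<and> (AE x in M. f x = g x)}"

definition Lp_space ::
  "'m measure \<Rightarrow> real \<Rightarrow> ('m \<Rightarrow> 'a::{real_normed_field, euclidean_space}) set set" where
  "Lp_space M p = Lp_fun M p // Lp_rel M p"

text \<open>The distance does not depend on the representatives that are picked.\<close>

definition Lp_dist ::
  "'m measure \<Rightarrow> real \<Rightarrow> ('m \<Rightarrow> 'a::{real_normed_field, euclidean_space}) set \<Rightarrow>
    ('m \<Rightarrow> 'a) set \<Rightarrow> real" where
  "Lp_dist M p F G = Lp_norm M p (\<lambda>x. (SOME f. f \<in> F) x - (SOME g. g \<in> G) x)"


section \<open>Compact operators on \<open>L\<^sup>p\<close>\<close>

text \<open>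
  An operator is given by a map \<open>T\<close> on functions that induces a linear map on the classes.
\<close>

definition Lp_linear_operator ::
  "'m measure \<Rightarrow> real \<Rightarrow>
    (('m \<Rightarrow> 'a::{real_normed_field, euclidean_space}) \<Rightarrow> ('m \<Rightarrow> 'a)) \<Rightarrow> bool" where
  "Lp_linear_operator M p T \<longleftrightarrow>
     (\<forall>f \<in> Lp_fun M p. T f \<in> Lp_fun M p) \<and>
     (\<forall>f \<in> Lp_fun M p. \<forall>g \<in> Lp_fun M p.
        (AE x in M. f x = g x) \<longrightarrow> (AE x in M. T f x = T g x)) \<and>
     (\<forall>f \<in> Lp_fun M p. \<forall>g \<in> Lp_fun M p. AE x in M. T (\<lambda>t. f t + g t) x = T f x + T g x) \<and>
     (\<forall>a. \<forall>f \<in> Lp_fun M p. AE x in M. T (\<lambda>t. a * f t) x = a * T f x)"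

definition Lp_map ::
  "'m measure \<Rightarrow> real \<Rightarrow>
    (('m \<Rightarrow> 'a::{real_normed_field, euclidean_space}) \<Rightarrow> ('m \<Rightarrow> 'a)) \<Rightarrow>
    ('m \<Rightarrow> 'a) set \<Rightarrow> ('m \<Rightarrow> 'a) set" where
  "Lp_map M p T F = {g \<in> Lp_fun M p. \<exists>f \<in> F. AE x in M. g x = T f x}"

definition Lp_compact_operator ::
  "'m measure \<Rightarrow> real \<Rightarrow>
    (('m \<Rightarrow> 'a::{real_normed_field, euclidean_space}) \<Rightarrow> ('m \<Rightarrow> 'a)) \<Rightarrow> bool" where
  "Lp_compact_operator M p T \<longleftrightarrow>
     Lp_linear_operator M p T \<and>
     (\<forall>U \<subseteq> Lp_space M p. Metric_space.mbounded (Lp_space M p) (Lp_dist M p) U \<longrightarrow>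
        compactin (Metric_space.mtopology (Lp_space M p) (Lp_dist M p))
          (Metric_space.mtopology (Lp_space M p) (Lp_dist M p) closure_of (Lp_map M p T ` U)))"


section \<open>The operators on the segment\<close>

abbreviation segment_measure :: "real \<Rightarrow> real measure" where
  "segment_measure c \<equiv> lebesgue_on {-c..c}"

definition S_op ::
  "real \<Rightarrow> (real \<Rightarrow> real) \<Rightarrow> real \<Rightarrow>
    (real \<Rightarrow> 'a::{real_normed_field, euclidean_space}) \<Rightarrow> real \<Rightarrow> 'a" where
  "S_op A k c f x = (A / 2) *\<^sub>R f x + (LINT y|segment_measure c. k (y - x) *\<^sub>R f y)"

definition q_kernel ::
  "real \<Rightarrow> (real \<Rightarrow> 'a::{real_normed_field, euclidean_space}) \<Rightarrow> (real \<Rightarrow> 'a) \<Rightarrow>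
    real \<Rightarrow> real \<Rightarrow> 'a" where
  "q_kernel c N1 N2 x y =
     (N1 (- y) * N2 x - N2 (- y) * N1 x) / (LINT t|segment_measure c. N1 t)"

definition Phi_integrand ::
  "real \<Rightarrow> (real \<Rightarrow> 'a::{real_normed_field, euclidean_space}) \<Rightarrow> (real \<Rightarrow> 'a) \<Rightarrow>
    real \<Rightarrow> real \<Rightarrow> real \<Rightarrow> 'a" where
  "Phi_integrand c N1 N2 x y s = q_kernel c N1 N2 ((s + x - y) / 2) ((s - x + y) / 2)"

text \<open>For \<open>x, y \<in> [-c, c]\<close> the lower limit below never exceeds the upper one.\<close>

definition Phi_kernel ::
  "real \<Rightarrow> (real \<Rightarrow> 'a::{real_normed_field, euclidean_space}) \<Rightarrow> (real \<Rightarrow> 'a) \<Rightarrow>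
    real \<Rightarrow> real \<Rightarrow> 'a" where
  "Phi_kernel c N1 N2 x y =
     (1 / 2) *\<^sub>R (LINT s|lebesgue_on {x + y .. 2 * c - \<bar>x - y\<bar>}. Phi_integrand c N1 N2 x y s)"

definition B_op ::
  "real \<Rightarrow> (real \<Rightarrow> 'a::{real_normed_field, euclidean_space}) \<Rightarrow> (real \<Rightarrow> 'a) \<Rightarrow>
    (real \<Rightarrow> 'a) \<Rightarrow> real \<Rightarrow> 'a" where
  "B_op c N1 N2 f x = (LINT y|segment_measure c. Phi_kernel c N1 N2 x y * f y)"

text \<open>
  The Bochner integral of a non-integrable function is \<open>0\<close> by convention. The next predicate
  says that this convention plays no role in \<open>B_op\<close> on \<open>L\<^sup>p\<close>: the integrals defining the
  kernel and the operator converge almost everywhere.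
\<close>

definition B_op_converges ::
  "real \<Rightarrow> (real \<Rightarrow> 'a::{real_normed_field, euclidean_space}) \<Rightarrow> (real \<Rightarrow> 'a) \<Rightarrow>
    real \<Rightarrow> bool" where
  "B_op_converges c N1 N2 p \<longleftrightarrow>
     (AE x in segment_measure c. AE y in segment_measure c.
        integrable (lebesgue_on {x + y .. 2 * c - \<bar>x - y\<bar>}) (Phi_integrand c N1 N2 x y)) \<and>
     (\<forall>f \<in> Lp_fun (segment_measure c) p. AE x in segment_measure c.
        integrable (segment_measure c) (\<lambda>y. Phi_kernel c N1 N2 x y * f y))"

end

theory Submission
  imports Defs
begin

text \<open>
  With \<open>N1\<close>, \<open>N2\<close> extended by \<open>0\<close>, the substitution \<open>s = x + y - 2 t\<close> gives
  \<open>\<Phi>(x, y) = (1/r) \<integral> (N1(t - y) N2(x - t) - N2(t - y) N1(x - t)) dt\<close> over \<open>t \<le> 0\<close>. Hence \<open>\<bar>\<Phi>(x, y)\<bar>\<close> is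
  at most \<open>H(x - y)\<close> with \<open>H\<close> a convolution of \<open>L\<^sup>1\<close> functions, and Schur's test bounds \<open>B\<close> on every
  \<open>L\<^sup>p\<close>. Replacing the factors that depend on \<open>x - t\<close> by bounded continuous functions close to them
  in \<open>L\<^sup>1\<close> changes \<open>B\<close> by an operator of small norm and leaves a kernel that is bounded and
  equicontinuous in \<open>x\<close>; such a kernel maps bounded sets of \<open>L\<^sup>p\<close> to sets that are totally bounded
  in the uniform norm. So \<open>B\<close> maps bounded sets to totally bounded ones, and \<open>L\<^sup>p\<close> is complete.
\<close>

section \<open>Minkowski and Hoelder inequalities\<close>

text \<open>The majorant H is merely integrable, so \<open>Phi_kernel\<close> need be neither
  bounded nor square integrable, and p = 1 must be covered as well. Schur's test fits because every
  row and every column of H(x - y) integrates to at most the L^1 norm of H, a bound independent of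
  p. Conjugate exponents are avoided altogether: the tangent line of t^p stands in for Hoelder's
  inequality and is valid down to p = 1.

  The obstacle to compactness is the cut-off \<open>t \<le> 0\<close> together with the roughness of
  both factors. In the variable t the cut-off involves neither x nor y, and x enters only through x
  - t. Smoothing those factors alone therefore makes the kernel continuous in x, uniformly in y,
  although the jump and the rough factors at t - y stay. Uniform continuity in x is exactly what
  lets step functions on one fixed grid approximate all images.

  Two points of care run through the file. Lebesgue measurability is not preserved by composition
  with (x, t) -> x - t on product spaces, hence the Borel representatives. Convolutions of L^1
  functions may be infinite on a null set, hence majorants with values in
  \<open>ennreal\<close>.\<close>

text \<open>The graph of t^p lies above its tangent at m. Since the left side is linear in t, the
  inequality can be integrated and m chosen afterwards, which is how it replaces Hoelder's
  inequality below.\<close>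

lemma powr_tangent:
  fixes m p t :: real
  assumes "p \<ge> 1" "t \<ge> 0" "m \<ge> 0"
  shows "p * m powr (p - 1) * t \<le> t powr p + (p - 1) * m powr p"
proof (cases "t = 0 \<or> m = 0")
  \<comment> \<open>For p = 1 and m = 0 the convention \<open>0 powr 0 = 0\<close> makes the left
    side vanish.\<close>
  case True
  then show ?thesis using assms by auto
next
  case False
  with assms have tm: "t > 0" "m > 0" by auto
  \<comment> \<open>Weighted arithmetic-geometric mean of t^p and m^p with weights 1/p and 1 -
    1/p.\<close>
  have "(t powr p) powr (1 / p) * (m powr p) powr (1 - 1 / p)
      \<le> 1 / p * t powr p + (1 - 1 / p) * m powr p"
    using assms tm by (intro Youngs_inequality_0) auto
  moreover have "p * (1 - 1 / p) = p - 1" using assms by (simp add: field_simps)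
  ultimately have "t * m powr (p - 1) \<le> 1 / p * t powr p + (1 - 1 / p) * m powr p"
    using assms tm by (simp add: powr_powr)
  then have "p * (t * m powr (p - 1)) \<le> p * (1 / p * t powr p + (1 - 1 / p) * m powr p)"
    using assms by (intro mult_left_mono) auto
  also have "\<dots> = t powr p + (p - 1) * m powr p" using assms by (simp add: field_simps)
  finally show ?thesis by (simp add: algebra_simps)
qed

text \<open>Convexity of t^p: (a + b)/(u + v) is the mean of a/u and b/v with weights u/(u + v) and
  v/(u + v). The two tangent inequalities at that mean are added with these weights. Integrated with
  u, v in the role of norms, this becomes Minkowski's inequality.\<close>

lemma powr_add_le:
  fixes a b u v p :: real
  assumes "p \<ge> 1" "a \<ge> 0" "b \<ge> 0" "u > 0" "v > 0"
  shows "(a + b) powr p \<le>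
    (u + v) powr p * (u / (u + v) * (a powr p / u powr p) + v / (u + v) * (b powr p / v powr p))"
proof -
  define l where "l = u / (u + v)"
  define m where "m = (a + b) / (u + v)"
  have l: "0 \<le> l" "l \<le> 1" "1 - l = v / (u + v)"
    using assms by (auto simp: l_def field_simps)
  have m: "m \<ge> 0" "m = l * (a / u) + (1 - l) * (b / v)"
    using assms by (auto simp: l(3) m_def add_divide_distrib) (simp add: l_def)
  have "p * m powr (p - 1) * m
      = l * (p * m powr (p - 1) * (a / u)) + (1 - l) * (p * m powr (p - 1) * (b / v))"
    by (subst (2) m(2)) (simp add: algebra_simps)
  also have "\<dots> \<le> l * ((a / u) powr p + (p - 1) * m powr p)
      + (1 - l) * ((b / v) powr p + (p - 1) * m powr p)"
    using assms l m by (intro add_mono mult_left_mono powr_tangent) auto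
  also have "\<dots> = l * (a / u) powr p + (1 - l) * (b / v) powr p + (p - 1) * m powr p"
    by (simp add: algebra_simps)
  also have "p * m powr (p - 1) * m = p * m powr p"
    using m assms by (cases "m = 0") (auto simp: powr_diff)
  finally have "m powr p \<le> l * (a / u) powr p + (1 - l) * (b / v) powr p"
    by (simp add: algebra_simps)
  then have "(u + v) powr p * m powr p
      \<le> (u + v) powr p * (l * (a / u) powr p + (1 - l) * (b / v) powr p)"
    by (intro mult_left_mono) auto
  also have "(u + v) powr p * m powr p = (a + b) powr p"
    using assms by (simp add: m_def powr_divide)
  finally show ?thesis using assms by (simp add: l powr_divide) (simp add: l_def)
qed

lemma Lp_fun_measurable [measurable_dest]: "f \<in> Lp_fun M p \<Longrightarrow> f \<in> borel_measurable M"
  by (simp add: Lp_fun_def)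

lemma Lp_norm_nonneg [simp]: "Lp_norm M p f \<ge> 0"
  by (simp add: Lp_norm_def)

lemma Lp_norm_powr:
  assumes "p \<ge> 1"
  shows "Lp_norm M p f powr p = (LINT x|M. norm (f x) powr p)"
  using assms by (simp add: Lp_norm_def powr_powr integral_nonneg_AE)

lemma nn_integral_Lp:
  assumes "p \<ge> 1" "f \<in> Lp_fun M p"
  shows "(\<integral>\<^sup>+x. ennreal (norm (f x) powr p) \<partial>M) = ennreal (Lp_norm M p f powr p)"
  using assms by (simp add: Lp_norm_powr nn_integral_eq_integral Lp_fun_def)

text \<open>The nonnegative integral exists without any prior integrability, so one estimate yields
  membership and the norm bound together. Minkowski, Fatou and Schur all end here.\<close>

lemma Lp_funI:
  fixes f :: "'m \<Rightarrow> 'a::{real_normed_field, euclidean_space}"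
  assumes "p \<ge> 1" "r \<ge> 0" and [measurable]: "f \<in> borel_measurable M"
    and le: "(\<integral>\<^sup>+x. ennreal (norm (f x) powr p) \<partial>M) \<le> ennreal (r powr p)"
  shows "f \<in> Lp_fun M p" "Lp_norm M p f \<le> r"
proof -
  have int: "integrable M (\<lambda>x. norm (f x) powr p)"
    by (rule integrableI_bounded)
       (use le ennreal_less_top[of "r powr p"] in \<open>auto simp: less_top[symmetric] top_unique\<close>)
  then show f: "f \<in> Lp_fun M p" by (simp add: Lp_fun_def)
  have "Lp_norm M p f powr p \<le> r powr p"
    using le nn_integral_Lp[OF \<open>p \<ge> 1\<close> f] by simp
  then show "Lp_norm M p f \<le> r"
    using assms by (meson Lp_norm_nonneg not_less powr_less_mono2 zero_less_one less_le_trans)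
qed

lemma Lp_norm_cong_AE:
  assumes "f \<in> borel_measurable M" "g \<in> borel_measurable M" "AE x in M. f x = g x"
  shows "Lp_norm M p f = Lp_norm M p g"
proof -
  have "(LINT x|M. norm (f x) powr p) = (LINT x|M. norm (g x) powr p)"
    using assms by (intro integral_cong_AE) (measurable, auto)
  then show ?thesis by (simp add: Lp_norm_def)
qed

lemma Lp_fun_cong_AE:
  assumes "f \<in> Lp_fun M p" "g \<in> borel_measurable M" "AE x in M. f x = g x"
  shows "g \<in> Lp_fun M p"
proof -
  have "integrable M (\<lambda>x. norm (g x) powr p) \<longleftrightarrow> integrable M (\<lambda>x. norm (f x) powr p)"
    using assms by (intro integrable_cong_AE) (auto simp: Lp_fun_def)
  with assms show ?thesis by (simp add: Lp_fun_def)
qed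

lemma Lp_norm_eq_0_iff:
  assumes "p \<ge> 1" "f \<in> Lp_fun M p"
  shows "Lp_norm M p f = 0 \<longleftrightarrow> (AE x in M. f x = 0)"
proof -
  have "Lp_norm M p f = 0 \<longleftrightarrow> (LINT x|M. norm (f x) powr p) = 0"
    by (simp add: Lp_norm_def)
  also have "\<dots> \<longleftrightarrow> (AE x in M. norm (f x) powr p = 0)"
    using assms by (intro integral_nonneg_eq_0_iff_AE) (auto simp: Lp_fun_def)
  finally show ?thesis by simp
qed

text \<open>\<open>powr_add_le\<close> is integrated with u and v strictly above the two norms. Each
  of the two integrals is then at most 1 after division by u^p or v^p, the weights add up to 1, and
  letting u, v decrease to the norms gives the triangle inequality.\<close>

lemma
  fixes f g :: "'m \<Rightarrow> 'a::{real_normed_field, euclidean_space}"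
  assumes p: "p \<ge> 1" and f: "f \<in> Lp_fun M p" and g: "g \<in> Lp_fun M p"
  shows Lp_fun_add: "(\<lambda>x. f x + g x) \<in> Lp_fun M p"
    and Lp_norm_triangle: "Lp_norm M p (\<lambda>x. f x + g x) \<le> Lp_norm M p f + Lp_norm M p g"
proof -
  note [measurable] = Lp_fun_measurable[OF f] Lp_fun_measurable[OF g]
  have combine: "(\<integral>\<^sup>+x. ennreal a * ennreal (norm (f x) powr p)
      + ennreal b * ennreal (norm (g x) powr p) \<partial>M)
      = ennreal (a * Lp_norm M p f powr p + b * Lp_norm M p g powr p)"
    if "a \<ge> 0" "b \<ge> 0" for a b
    using p that by (simp add: nn_integral_add nn_integral_cmult nn_integral_Lp f g ennreal_mult)
  have *: "(\<lambda>x. f x + g x) \<in> Lp_fun M p" "Lp_norm M p (\<lambda>x. f x + g x) \<le> u + v"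
    if u: "u > Lp_norm M p f" and v: "v > Lp_norm M p g" for u v
  proof -
    \<comment> \<open>The strict inequalities keep u and v positive even if f or g vanishes almost
      everywhere.\<close>
    have pos: "u > 0" "v > 0" using u v by (auto intro: le_less_trans[OF Lp_norm_nonneg])
    have "(\<integral>\<^sup>+x. ennreal (norm (f x + g x) powr p) \<partial>M)
        \<le> (\<integral>\<^sup>+x. ennreal ((u + v) powr p * (u / (u + v) / u powr p)) * ennreal (norm (f x) powr p)
          + ennreal ((u + v) powr p * (v / (u + v) / v powr p)) * ennreal (norm (g x) powr p) \<partial>M)"
    proof (rule nn_integral_mono)
      fix x
      have "norm (f x + g x) powr p \<le> (norm (f x) + norm (g x)) powr p"
        using p by (intro powr_mono2 norm_triangle_ineq) auto
      also have "\<dots> \<le> (u + v) powr p * (u / (u + v) * (norm (f x) powr p / u powr p)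
          + v / (u + v) * (norm (g x) powr p / v powr p))"
        using p pos by (intro powr_add_le) auto
      also have "\<dots> = (u + v) powr p * (u / (u + v) / u powr p) * norm (f x) powr p
          + (u + v) powr p * (v / (u + v) / v powr p) * norm (g x) powr p"
        by (simp add: algebra_simps)
      finally show "ennreal (norm (f x + g x) powr p)
        \<le> ennreal ((u + v) powr p * (u / (u + v) / u powr p)) * ennreal (norm (f x) powr p)
          + ennreal ((u + v) powr p * (v / (u + v) / v powr p)) * ennreal (norm (g x) powr p)"
        using pos by (simp add: ennreal_mult[symmetric] ennreal_plus[symmetric] del: ennreal_plus)
    qed
    also have "\<dots> = ennreal ((u + v) powr p * (u / (u + v) / u powr p) * Lp_norm M p f powr p
          + (u + v) powr p * (v / (u + v) / v powr p) * Lp_norm M p g powr p)"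
      using pos by (intro combine) auto
    also have "\<dots> \<le> ennreal ((u + v) powr p * (u / (u + v) / u powr p) * u powr p
          + (u + v) powr p * (v / (u + v) / v powr p) * v powr p)"
      using p pos u v by (intro ennreal_leI add_mono mult_left_mono powr_mono2) auto
    also have "\<dots> = ennreal ((u + v) powr p * ((u + v) / (u + v)))"
      using pos by (simp add: distrib_left[symmetric] add_divide_distrib[symmetric])
    also have "\<dots> = ennreal ((u + v) powr p)" using pos by simp
    finally have "(\<integral>\<^sup>+x. ennreal (norm (f x + g x) powr p) \<partial>M) \<le> ennreal ((u + v) powr p)" .
    with p pos show "(\<lambda>x. f x + g x) \<in> Lp_fun M p" "Lp_norm M p (\<lambda>x. f x + g x) \<le> u + v"
      using Lp_funI[of p "u + v" "\<lambda>x. f x + g x" M] by auto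
  qed
  show "(\<lambda>x. f x + g x) \<in> Lp_fun M p"
    by (rule *(1)[of "Lp_norm M p f + 1" "Lp_norm M p g + 1"]) auto
  show "Lp_norm M p (\<lambda>x. f x + g x) \<le> Lp_norm M p f + Lp_norm M p g"
  proof (rule field_le_epsilon)
    fix e :: real assume "e > 0"
    then show "Lp_norm M p (\<lambda>x. f x + g x) \<le> Lp_norm M p f + Lp_norm M p g + e"
      using *(2)[of "Lp_norm M p f + e / 2" "Lp_norm M p g + e / 2"] by auto
  qed
qed

lemma Lp_fun_cmult:
  fixes f :: "'m \<Rightarrow> 'a::{real_normed_field, euclidean_space}"
  assumes "f \<in> Lp_fun M p"
  shows "(\<lambda>x. a * f x) \<in> Lp_fun M p"
  using assms by (auto simp: Lp_fun_def norm_mult powr_mult)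

lemma Lp_fun_diff:
  fixes f g :: "'m \<Rightarrow> 'a::{real_normed_field, euclidean_space}"
  assumes "p \<ge> 1" "f \<in> Lp_fun M p" "g \<in> Lp_fun M p"
  shows "(\<lambda>x. f x - g x) \<in> Lp_fun M p"
  using Lp_fun_add[OF assms(1,2) Lp_fun_cmult[OF assms(3), of "-1"]] by simp

lemma Lp_norm_minus_commute: "Lp_norm M p (\<lambda>x. f x - g x) = Lp_norm M p (\<lambda>x. g x - f x)"
  by (simp add: Lp_norm_def norm_minus_commute)

lemma Lp_norm_diff_triangle:
  fixes f g h :: "'m \<Rightarrow> 'a::{real_normed_field, euclidean_space}"
  assumes "p \<ge> 1" "f \<in> Lp_fun M p" "g \<in> Lp_fun M p" "h \<in> Lp_fun M p"
  shows "Lp_norm M p (\<lambda>x. f x - h x)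
    \<le> Lp_norm M p (\<lambda>x. f x - g x) + Lp_norm M p (\<lambda>x. g x - h x)"
  using Lp_norm_triangle[of p "\<lambda>x. f x - g x" M "\<lambda>x. g x - h x"] assms
  by (simp add: Lp_fun_diff)

lemma Lp_norm_bounded:
  fixes f :: "'m \<Rightarrow> 'a::{real_normed_field, euclidean_space}"
  assumes "finite_measure M" "p \<ge> 1" "f \<in> borel_measurable M" "b \<ge> 0"
    and "\<And>x. x \<in> space M \<Longrightarrow> norm (f x) \<le> b"
  shows "f \<in> Lp_fun M p" "Lp_norm M p f \<le> b * measure M (space M) powr (1 / p)"
proof -
  interpret finite_measure M by fact
  have "(\<integral>\<^sup>+x. ennreal (norm (f x) powr p) \<partial>M) \<le> (\<integral>\<^sup>+x. ennreal (b powr p) \<partial>M)"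
    using assms by (intro nn_integral_mono ennreal_leI powr_mono2) auto
  also have "\<dots> = ennreal ((b * measure M (space M) powr (1 / p)) powr p)"
    using assms by (simp add: emeasure_eq_measure ennreal_mult[symmetric] powr_mult powr_powr)
  finally have le: "(\<integral>\<^sup>+x. ennreal (norm (f x) powr p) \<partial>M)
      \<le> ennreal ((b * measure M (space M) powr (1 / p)) powr p)" .
  show "f \<in> Lp_fun M p" "Lp_norm M p f \<le> b * measure M (space M) powr (1 / p)"
    using Lp_funI[OF assms(2) _ assms(3) le] assms(4) by auto
qed

text \<open>A pointwise bound of |f| by m + |f|^p m^(1 - p) is integrated with m slightly above the
  norm. The second term contributes at most m, hence the constant
  \<open>measure M (space M) + 1\<close>, which is cruder than Hoelder's but independent of
  p.\<close>

lemma
  fixes f :: "'m \<Rightarrow> 'a::{real_normed_field, euclidean_space}"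
  assumes M: "finite_measure M" and p: "p \<ge> 1" and f: "f \<in> Lp_fun M p"
  shows Lp_fun_integrable: "integrable M f"
    and integral_norm_le_Lp_norm:
      "(LINT x|M. norm (f x)) \<le> (measure M (space M) + 1) * Lp_norm M p f"
proof -
  interpret finite_measure M by fact
  note [measurable] = Lp_fun_measurable[OF f]
  have *: "integrable M f" "(LINT x|M. norm (f x)) \<le> (measure M (space M) + 1) * m"
    if m: "m > Lp_norm M p f" for m
  proof -
    have "m > 0" using m by (auto intro: le_less_trans[OF Lp_norm_nonneg])
    \<comment> \<open>Where |f x| exceeds m, the factor (|f x| / m)^(p - 1) is at least 1.\<close>
    have "norm (f x) \<le> m + norm (f x) powr p * m powr (1 - p)" for x
    proof (cases "norm (f x) \<le> m")
      case False
      then have "norm (f x) = norm (f x) powr p * norm (f x) powr (1 - p)"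
        using \<open>m > 0\<close> by (simp add: powr_add[symmetric])
      also have "\<dots> \<le> norm (f x) powr p * m powr (1 - p)"
        using False \<open>m > 0\<close> p by (intro mult_left_mono powr_mono2') auto
      finally show ?thesis using \<open>m > 0\<close> by simp
    qed (simp add: add_increasing2)
    moreover have int: "integrable M (\<lambda>x. m + norm (f x) powr p * m powr (1 - p))"
      using f by (auto simp: Lp_fun_def)
    ultimately show "integrable M f"
      by (intro Bochner_Integration.integrable_bound[OF int])
         (auto intro!: AE_I2 order_trans[OF _ abs_ge_self])
    then have "(LINT x|M. norm (f x)) \<le> (LINT x|M. m + norm (f x) powr p * m powr (1 - p))"
      using int \<open>\<And>x. norm (f x) \<le> _\<close> by (intro integral_mono) auto
    also have "\<dots> = measure M (space M) * m + Lp_norm M p f powr p * m powr (1 - p)"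
      using f p by (simp add: Lp_fun_def Lp_norm_powr)
    also have "\<dots> \<le> measure M (space M) * m + m powr p * m powr (1 - p)"
      using m p by (intro add_left_mono mult_right_mono powr_mono2) auto
    also have "\<dots> = (measure M (space M) + 1) * m"
      using \<open>m > 0\<close> by (simp add: powr_add[symmetric] algebra_simps)
    finally show "(LINT x|M. norm (f x)) \<le> (measure M (space M) + 1) * m" .
  qed
  show "integrable M f" by (rule *(1)[of "Lp_norm M p f + 1"]) simp
  show "(LINT x|M. norm (f x)) \<le> (measure M (space M) + 1) * Lp_norm M p f"
  proof (rule field_le_epsilon)
    fix e :: real assume "e > 0"
    have "measure M (space M) + 1 > 0" by (simp add: add_nonneg_pos)
    then show "(LINT x|M. norm (f x)) \<le> (measure M (space M) + 1) * Lp_norm M p f + e"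
      using *(2)[of "Lp_norm M p f + e / (measure M (space M) + 1)"] \<open>e > 0\<close>
      by (simp add: distrib_left)
  qed
qed

section \<open>The metric space \<open>L\<^sup>p\<close>\<close>

text \<open>\<open>mtotally_bounded\<close> demands centres inside S, whereas the nets constructed
  later consist of step functions that need not be images. Balls of half the radius that meet S are
  recentred at a point of S.\<close>

lemma (in Metric_space) mtotally_boundedI:
  assumes S: "S \<subseteq> M"
    and net: "\<And>e. e > 0 \<Longrightarrow> \<exists>K. finite K \<and> K \<subseteq> M \<and> S \<subseteq> (\<Union>x\<in>K. mball x e)"
  shows "mtotally_bounded S"
  unfolding mtotally_bounded_def
proof (intro allI impI)
  fix e :: real assume "e > 0"
  then obtain K where K: "finite K" "K \<subseteq> M" "S \<subseteq> (\<Union>x\<in>K. mball x (e / 2))"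
    using net[of "e / 2"] by auto
  define c where "c x = (SOME s. s \<in> S \<inter> mball x (e / 2))" for x
  define K' where "K' = {x \<in> K. S \<inter> mball x (e / 2) \<noteq> {}}"
  have c: "c x \<in> S \<inter> mball x (e / 2)" if "x \<in> K'" for x
    using that by (simp add: c_def K'_def some_in_eq del: Int_iff)
  show "\<exists>K. finite K \<and> K \<subseteq> S \<and> S \<subseteq> (\<Union>x\<in>K. mball x e)"
  proof (intro exI conjI)
    show "finite (c ` K')" using K by (simp add: K'_def)
    show "c ` K' \<subseteq> S" using c by auto
    show "S \<subseteq> (\<Union>x\<in>c ` K'. mball x e)"
    proof
      fix s assume "s \<in> S"
      then obtain x where x: "x \<in> K" "s \<in> mball x (e / 2)" using K by auto
      then have "x \<in> K'" using \<open>s \<in> S\<close> by (auto simp: K'_def)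
      then have "d (c x) s < e"
        using c[of x] x triangle'[of "c x" x s] commute by (auto simp: in_mball)
      then have "s \<in> mball (c x) e" using c[OF \<open>x \<in> K'\<close>] \<open>s \<in> S\<close> S by (auto simp: in_mball)
      then show "s \<in> (\<Union>x\<in>c ` K'. mball x e)" using \<open>x \<in> K'\<close> by blast
    qed
  qed
qed

lemma equiv_Lp_rel:
  fixes M :: "'m measure" and p :: real
  shows "equiv (Lp_fun M p :: ('m \<Rightarrow> 'a::{real_normed_field, euclidean_space}) set) (Lp_rel M p)"
    (is "equiv ?A ?R")
proof (rule equivI)
  show "?R \<subseteq> ?A \<times> ?A" by (auto simp: Lp_rel_def)
  show "refl_on ?A ?R" by (auto simp: refl_on_def Lp_rel_def)
  show "sym ?R" by (auto simp: sym_def Lp_rel_def eq_commute)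
  show "trans ?R"
  proof (rule transI)
    fix f g h :: "'m \<Rightarrow> 'a" assume "(f, g) \<in> ?R" "(g, h) \<in> ?R"
    then show "(f, h) \<in> ?R" by (auto simp: Lp_rel_def elim: AE_mp)
  qed
qed

lemma Lp_spaceD:
  assumes "F \<in> Lp_space M p"
  shows "F \<noteq> {}" "\<And>f. f \<in> F \<Longrightarrow> f \<in> Lp_fun M p"
    "\<And>f g. f \<in> F \<Longrightarrow> g \<in> F \<longleftrightarrow> g \<in> Lp_fun M p \<and> (AE x in M. f x = g x)"
proof -
  show "F \<noteq> {}"
    using assms in_quotient_imp_non_empty[OF equiv_Lp_rel] by (auto simp: Lp_space_def)
  show 1: "f \<in> Lp_fun M p" if "f \<in> F" for f
    using assms that in_quotient_imp_subset[OF equiv_Lp_rel] by (auto simp: Lp_space_def)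
  show "g \<in> F \<longleftrightarrow> g \<in> Lp_fun M p \<and> (AE x in M. f x = g x)" if "f \<in> F" for f g
  proof -
    have "g \<in> F \<longleftrightarrow> (f, g) \<in> Lp_rel M p"
      using assms that in_quotient_imp_closed[OF equiv_Lp_rel]
        in_quotient_imp_in_rel[OF equiv_Lp_rel, of F M p f g]
      by (auto simp: Lp_space_def)
    then show ?thesis using 1[OF that] by (auto simp: Lp_rel_def)
  qed
qed

definition Lp_class ::
  "'m measure \<Rightarrow> real \<Rightarrow> ('m \<Rightarrow> 'a::{real_normed_field, euclidean_space}) \<Rightarrow> ('m \<Rightarrow> 'a) set" where
  "Lp_class M p f = {g \<in> Lp_fun M p. AE x in M. f x = g x}"

lemma Lp_class_in_space: "f \<in> Lp_fun M p \<Longrightarrow> Lp_class M p f \<in> Lp_space M p"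
  unfolding Lp_space_def Lp_class_def
  by (rule quotientI[of f, THEN back_subst[of "\<lambda>F. F \<in> _"]]) (auto simp: Lp_rel_def)

lemma Lp_class_self: "f \<in> Lp_fun M p \<Longrightarrow> f \<in> Lp_class M p f"
  by (auto simp: Lp_class_def)

lemma Lp_space_eq_Lp_class:
  assumes "F \<in> Lp_space M p" "f \<in> F" shows "F = Lp_class M p f"
  using Lp_spaceD(3)[OF assms] by (auto simp: Lp_class_def)

lemma Lp_dist_eq:
  assumes "F \<in> Lp_space M p" "G \<in> Lp_space M p" "f \<in> F" "g \<in> G"
  shows "Lp_dist M p F G = Lp_norm M p (\<lambda>x. f x - g x)"
proof -
  define f' g' where "f' = (SOME f. f \<in> F)" and "g' = (SOME g. g \<in> G)"
  have in': "f' \<in> F" "g' \<in> G"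
    unfolding f'_def g'_def by (rule someI[of _ f] someI[of _ g], fact)+
  have AE: "AE x in M. f' x = f x" "AE x in M. g' x = g x"
    using Lp_spaceD(3) assms in' by metis+
  have [measurable]: "f \<in> borel_measurable M" "g \<in> borel_measurable M"
      "f' \<in> borel_measurable M" "g' \<in> borel_measurable M"
    using assms in' Lp_spaceD(2) Lp_fun_measurable by metis+
  have "Lp_norm M p (\<lambda>x. f' x - g' x) = Lp_norm M p (\<lambda>x. f x - g x)"
    by (rule Lp_norm_cong_AE) (use AE in auto)
  then show ?thesis by (simp add: Lp_dist_def f'_def g'_def)
qed

lemma Metric_space_Lp:
  assumes p: "p \<ge> 1"
  shows "Metric_space (Lp_space M p :: ('m \<Rightarrow> 'a::{real_normed_field, euclidean_space}) set set)
    (Lp_dist M p)"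
proof
  show "0 \<le> Lp_dist M p F G" for F G :: "('m \<Rightarrow> 'a) set" by (simp add: Lp_dist_def)
  show "Lp_dist M p F G = Lp_dist M p G F" for F G :: "('m \<Rightarrow> 'a) set"
    unfolding Lp_dist_def by (rule Lp_norm_minus_commute)
next
  fix F G :: "('m \<Rightarrow> 'a) set"
  assume FG: "F \<in> Lp_space M p" "G \<in> Lp_space M p"
  then obtain f g where fg: "f \<in> F" "g \<in> G" using Lp_spaceD(1) by blast
  then have L: "f \<in> Lp_fun M p" "g \<in> Lp_fun M p" using FG Lp_spaceD(2) by auto
  have "Lp_dist M p F G = 0 \<longleftrightarrow> (AE x in M. f x - g x = 0)"
    using Lp_dist_eq[OF FG fg] Lp_norm_eq_0_iff[OF p Lp_fun_diff[OF p L]] by simp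
  also have "\<dots> \<longleftrightarrow> g \<in> F" using Lp_spaceD(3)[OF FG(1) fg(1), of g] L by simp
  also have "\<dots> \<longleftrightarrow> F = G"
    using fg Lp_space_eq_Lp_class FG by metis
  finally show "Lp_dist M p F G = 0 \<longleftrightarrow> F = G" .
next
  fix F G H :: "('m \<Rightarrow> 'a) set"
  assume FG: "F \<in> Lp_space M p" "G \<in> Lp_space M p" "H \<in> Lp_space M p"
  then obtain f g h where fg: "f \<in> F" "g \<in> G" "h \<in> H"
    using Lp_spaceD(1) by (metis all_not_in_conv)
  then have L: "f \<in> Lp_fun M p" "g \<in> Lp_fun M p" "h \<in> Lp_fun M p" using FG Lp_spaceD(2) by auto
  show "Lp_dist M p F H \<le> Lp_dist M p F G + Lp_dist M p G H"
    using Lp_norm_diff_triangle[OF p L] fg FG by (simp add: Lp_dist_eq)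
qed

text \<open>On a finite measure space \<open>L\<^sup>p\<close>-Cauchy sequences are \<open>L\<^sup>1\<close>-Cauchy, which yields an almost
  everywhere convergent subsequence; Fatou's lemma turns its limit into an \<open>L\<^sup>p\<close>-limit.\<close>

lemma mcomplete_Lp:
  assumes M: "finite_measure M" and p: "p \<ge> 1"
  shows "Metric_space.mcomplete
    (Lp_space M p :: ('m \<Rightarrow> 'a::{real_normed_field, euclidean_space}) set set) (Lp_dist M p)"
proof -
  interpret Metric_space "Lp_space M p :: ('m \<Rightarrow> 'a) set set" "Lp_dist M p"
    by (rule Metric_space_Lp[OF p])
  interpret finite_measure M by fact
  show ?thesis unfolding mcomplete_def
  proof (intro allI impI)
    fix \<sigma> :: "nat \<Rightarrow> ('m \<Rightarrow> 'a) set"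
    assume "MCauchy \<sigma>"
    then have \<sigma>: "\<sigma> n \<in> Lp_space M p" for n by (auto simp: MCauchy_def)
    from \<open>MCauchy \<sigma>\<close> have cauchy: "\<exists>N. \<forall>m\<ge>N. \<forall>n\<ge>N. Lp_dist M p (\<sigma> m) (\<sigma> n) < e" if "e > 0" for e
      using that by (auto simp: MCauchy_def)
    define f where "f n = (SOME f. f \<in> \<sigma> n)" for n
    have f: "f n \<in> \<sigma> n" for n
      unfolding f_def using Lp_spaceD(1)[OF \<sigma>] by (simp add: some_in_eq)
    then have L: "f n \<in> Lp_fun M p" for n using \<sigma> Lp_spaceD(2) by blast
    then have [measurable]: "f n \<in> borel_measurable M" for n by (rule Lp_fun_measurable)
    have dist: "Lp_dist M p (\<sigma> m) (\<sigma> n) = Lp_norm M p (\<lambda>x. f m x - f n x)" for m n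
      using Lp_dist_eq \<sigma> f by metis
    define K where "K = measure M (space M) + 1"
    have K: "K > 0" by (simp add: K_def add_nonneg_pos)
    have "\<exists>N. \<forall>i\<ge>N. \<forall>j\<ge>N. (LINT x|M. norm (f i x - f j x)) < e" if "e > 0" for e
    proof -
      obtain N where "\<forall>m\<ge>N. \<forall>n\<ge>N. Lp_dist M p (\<sigma> m) (\<sigma> n) < e / K"
        using cauchy[of "e / K"] K \<open>e > 0\<close> by auto
      then have "K * Lp_norm M p (\<lambda>x. f i x - f j x) < e" if "i \<ge> N" "j \<ge> N" for i j
        using that K dist by (simp add: pos_less_divide_eq mult.commute)
      then show ?thesis
        using integral_norm_le_Lp_norm[OF M p Lp_fun_diff[OF p L L]] K_def
        by (meson le_less_trans)
    qed
    then obtain r where r: "strict_mono r" "AE x in M. Cauchy (\<lambda>i. f (r i) x)"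
      by (rule cauchy_L1_AE_cauchy_subseq[OF Lp_fun_integrable[OF M p L]])
    define g where "g x = lim (\<lambda>i. f (r i) x)" for x
    have [measurable]: "g \<in> borel_measurable M" unfolding g_def by measurable
    have lim: "AE x in M. (\<lambda>i. f (r i) x) \<longlonglongrightarrow> g x"
      using r(2) by eventually_elim (auto simp: g_def Cauchy_convergent_iff convergent_LIMSEQ_iff)
    \<comment> \<open>Fatou's lemma in i with n fixed: the Cauchy bound for
      \<open>f (r i) - f n\<close> passes to \<open>g - f n\<close>, giving membership and smallness
      at once. Along the whole sequence n, not only the subsequence, the differences are
      controlled.\<close>
    have tail: "\<exists>N. \<forall>n\<ge>N. (\<lambda>x. g x - f n x) \<in> Lp_fun M p \<and> Lp_norm M p (\<lambda>x. g x - f n x) \<le> e"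
      if "e > 0" for e
    proof -
      obtain N where N: "\<forall>m\<ge>N. \<forall>n\<ge>N. Lp_dist M p (\<sigma> m) (\<sigma> n) < e"
        using cauchy[OF \<open>e > 0\<close>] by auto
      have "(\<integral>\<^sup>+x. ennreal (norm (g x - f n x) powr p) \<partial>M) \<le> ennreal (e powr p)" if "n \<ge> N" for n
      proof -
        have "AE x in M. ennreal (norm (g x - f n x) powr p)
            = liminf (\<lambda>i. ennreal (norm (f (r i) x - f n x) powr p))"
          using lim
        proof eventually_elim
          case (elim x)
          then have "(\<lambda>i. ennreal (norm (f (r i) x - f n x) powr p))
              \<longlonglongrightarrow> ennreal (norm (g x - f n x) powr p)"
            using p by (intro tendsto_ennrealI tendsto_powr' tendsto_intros) auto
          from lim_imp_Liminf[OF _ this] show ?case by simp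
        qed
        then have "(\<integral>\<^sup>+x. ennreal (norm (g x - f n x) powr p) \<partial>M)
            = (\<integral>\<^sup>+x. liminf (\<lambda>i. ennreal (norm (f (r i) x - f n x) powr p)) \<partial>M)"
          by (rule nn_integral_cong_AE)
        also have "\<dots> \<le> liminf (\<lambda>i. \<integral>\<^sup>+x. ennreal (norm (f (r i) x - f n x) powr p) \<partial>M)"
          by (rule nn_integral_liminf) measurable
        also have "\<dots> \<le> ennreal (e powr p)"
        proof (rule Liminf_le)
          have "(\<integral>\<^sup>+x. ennreal (norm (f (r i) x - f n x) powr p) \<partial>M) \<le> ennreal (e powr p)"
            if "i \<ge> N" for i
          proof -
            have "r i \<ge> N" using strict_mono_imp_increasing[OF r(1), of i] that by simp
            then have "Lp_norm M p (\<lambda>x. f (r i) x - f n x) < e" using N \<open>n \<ge> N\<close> dist by metis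
            then show ?thesis
              using p by (auto simp: nn_integral_Lp Lp_fun_diff L intro!: ennreal_leI powr_mono2)
          qed
          then show "\<forall>\<^sub>F i in sequentially.
              (\<integral>\<^sup>+x. ennreal (norm (f (r i) x - f n x) powr p) \<partial>M) \<le> ennreal (e powr p)"
            by (rule eventually_sequentiallyI)
        qed simp
        finally show ?thesis .
      qed
      then show ?thesis
        using Lp_funI[OF p less_imp_le[OF \<open>e > 0\<close>], of "\<lambda>x. g x - f _ x" M] by (auto intro!: exI[of _ N])
    qed
    obtain N where "(\<lambda>x. g x - f N x) \<in> Lp_fun M p" using tail[of 1] by auto
    then have g: "g \<in> Lp_fun M p" using Lp_fun_add[OF p _ L, of "\<lambda>x. g x - f N x" N] by simp
    have G: "Lp_class M p g \<in> Lp_space M p" "g \<in> Lp_class M p g"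
      using g by (auto intro: Lp_class_in_space Lp_class_self)
    have "limitin mtopology \<sigma> (Lp_class M p g) sequentially"
    proof (unfold limit_metric_sequentially, intro conjI allI impI G)
      fix e :: real assume "e > 0"
      then obtain N where "\<forall>n\<ge>N. Lp_norm M p (\<lambda>x. g x - f n x) \<le> e / 2" using tail[of "e / 2"] by auto
      then have "\<forall>n\<ge>N. Lp_dist M p (\<sigma> n) (Lp_class M p g) < e"
        using \<open>e > 0\<close> Lp_dist_eq[OF \<sigma> G(1) f G(2)] Lp_norm_minus_commute[of M p g]
        by (metis field_sum_of_halves less_add_same_cancel1 half_gt_zero order_le_less_trans)
      then show "\<exists>N. \<forall>n\<ge>N. \<sigma> n \<in> Lp_space M p \<and> Lp_dist M p (\<sigma> n) (Lp_class M p g) < e"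
        using \<sigma> by auto
    qed
    then show "\<exists>G. limitin mtopology \<sigma> G sequentially" by blast
  qed
qed

text \<open>In a complete metric space totally bounded sets have compact closure, so finite nets for
  the image of each norm ball suffice. The net may consist of arbitrary L^p functions.\<close>

lemma Lp_compact_operatorI:
  fixes T :: "('m \<Rightarrow> 'a::{real_normed_field, euclidean_space}) \<Rightarrow> 'm \<Rightarrow> 'a"
  assumes M: "finite_measure M" and p: "p \<ge> 1" and T: "Lp_linear_operator M p T"
    and net: "\<And>R e. R > 0 \<Longrightarrow> e > 0 \<Longrightarrow> \<exists>G. finite G \<and> G \<subseteq> Lp_fun M p \<and>
      (\<forall>f\<in>Lp_fun M p. Lp_norm M p f \<le> R \<longrightarrow> (\<exists>g\<in>G. Lp_norm M p (\<lambda>x. T f x - g x) < e))"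
  shows "Lp_compact_operator M p T"
  unfolding Lp_compact_operator_def
proof (intro conjI T allI impI)
  interpret Metric_space "Lp_space M p :: ('m \<Rightarrow> 'a) set set" "Lp_dist M p"
    by (rule Metric_space_Lp[OF p])
  have TL: "T f \<in> Lp_fun M p" if "f \<in> Lp_fun M p" for f
    using T that by (auto simp: Lp_linear_operator_def)
  have map: "Lp_map M p T F = Lp_class M p (T f)" if "F \<in> Lp_space M p" "f \<in> F" for F f
  proof -
    have f: "f \<in> Lp_fun M p" using Lp_spaceD(2) that by blast
    have "(AE x in M. g x = T f' x) \<longleftrightarrow> (AE x in M. T f x = g x)" if "f' \<in> F" for f' g
    proof -
      have "f' \<in> Lp_fun M p" "AE x in M. f x = f' x"
        using Lp_spaceD(3)[OF \<open>F \<in> _\<close> \<open>f \<in> F\<close>, of f'] that by auto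
      then have "AE x in M. T f x = T f' x"
        using T f by (auto simp: Lp_linear_operator_def)
      then show ?thesis by (auto elim: eventually_elim2)
    qed
    then show ?thesis using that by (auto simp: Lp_map_def Lp_class_def)
  qed
  fix U :: "('m \<Rightarrow> 'a) set set"
  assume U: "U \<subseteq> Lp_space M p" "mbounded U"
  have sub: "Lp_map M p T ` U \<subseteq> Lp_space M p"
  proof safe
    fix F assume "F \<in> U"
    moreover obtain f where "f \<in> F" using \<open>F \<in> U\<close> U Lp_spaceD(1) by blast
    ultimately show "Lp_map M p T F \<in> Lp_space M p"
      using U map TL Lp_spaceD(2) Lp_class_in_space by (metis subsetD)
  qed
  \<comment> \<open>Boundedness of U is a statement about mutual distances. Adding the class of 0
    turns it into a bound R on the norms of all representatives.\<close>
  define Z where "Z = Lp_class M p (\<lambda>x. 0 :: 'a)"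
  have Z0: "(\<lambda>x. 0 :: 'a) \<in> Lp_fun M p" using p by (simp add: Lp_fun_def)
  have Z: "Z \<in> Lp_space M p" "(\<lambda>x. 0) \<in> Z"
    using Z0 by (auto simp: Z_def intro: Lp_class_in_space Lp_class_self)
  have "mbounded (insert Z U)" using U Z by (simp add: mbounded_insert)
  then obtain R where R: "R > 0" "\<And>F. F \<in> U \<Longrightarrow> Lp_dist M p F Z \<le> R"
    unfolding mbounded_alt_pos by blast
  have normR: "Lp_norm M p f \<le> R" if "F \<in> U" "f \<in> F" for F f
    using R(2)[OF that(1)] Lp_dist_eq[of F M p Z f "\<lambda>x. 0"] that U Z by auto
  have "mtotally_bounded (Lp_map M p T ` U)"
  proof (rule mtotally_boundedI[OF sub])
    fix e :: real assume "e > 0"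
    from net[OF R(1) this] obtain G where G: "finite G" "G \<subseteq> Lp_fun M p"
      and cov: "\<And>f. f \<in> Lp_fun M p \<Longrightarrow> Lp_norm M p f \<le> R \<Longrightarrow>
        \<exists>g\<in>G. Lp_norm M p (\<lambda>x. T f x - g x) < e" by metis
    show "\<exists>K. finite K \<and> K \<subseteq> Lp_space M p \<and> Lp_map M p T ` U \<subseteq> (\<Union>x\<in>K. mball x e)"
    proof (intro exI conjI)
      show "finite (Lp_class M p ` G)" using G by simp
      show "Lp_class M p ` G \<subseteq> Lp_space M p" using G Lp_class_in_space by blast
      show "Lp_map M p T ` U \<subseteq> (\<Union>x\<in>Lp_class M p ` G. mball x e)"
      proof safe
        fix F assume F: "F \<in> U"
        then have FL: "F \<in> Lp_space M p" using U by auto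
        then obtain f where f: "f \<in> F" using Lp_spaceD(1) by blast
        then have fL: "f \<in> Lp_fun M p" using FL Lp_spaceD(2) by blast
        then obtain g where g: "g \<in> G" "Lp_norm M p (\<lambda>x. T f x - g x) < e"
          using cov normR F f by blast
        then have gL: "g \<in> Lp_fun M p" using G by auto
        have "Lp_dist M p (Lp_class M p (T f)) (Lp_class M p g) < e"
          using g Lp_dist_eq[OF Lp_class_in_space Lp_class_in_space Lp_class_self Lp_class_self,
              OF TL[OF fL] gL TL[OF fL] gL] by simp
        then have "Lp_map M p T F \<in> mball (Lp_class M p g) e"
          using TL[OF fL] gL by (simp add: map[OF FL f] in_mball Lp_class_in_space commute)
        then show "Lp_map M p T F \<in> (\<Union>x\<in>Lp_class M p ` G. mball x e)" using g by blast
      qed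
    qed
  qed
  then show "compactin mtopology (mtopology closure_of (Lp_map M p T ` U))"
    using mtotally_bounded_eq_compact_closure_of[OF mcomplete_Lp[OF M p]] by blast
qed

section \<open>Schur's test\<close>

text \<open>Write F x for the integral of G x y |f y| and P x for that of G x y |f y|^p. Integrating
  the tangent inequality against G x and using the row bound gives F^p at most h^(p - 1) P. Tonelli
  and the column bound give the integral of P at most h times the p-th power of the norm.\<close>

lemma Schur_test_nn:
  fixes f :: "'m \<Rightarrow> 'a::{real_normed_field, euclidean_space}" and G :: "'m \<Rightarrow> 'm \<Rightarrow> ennreal"
  assumes M: "sigma_finite_measure M" and p: "p \<ge> 1" and h: "h > 0"
    and G [measurable]: "case_prod G \<in> borel_measurable (M \<Otimes>\<^sub>M M)"
    and row: "\<And>x. x \<in> space M \<Longrightarrow> (\<integral>\<^sup>+y. G x y \<partial>M) \<le> ennreal h"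
    and col: "\<And>y. y \<in> space M \<Longrightarrow> (\<integral>\<^sup>+x. G x y \<partial>M) \<le> ennreal h"
    and f: "f \<in> Lp_fun M p"
  shows "AE x in M. (\<integral>\<^sup>+y. G x y * ennreal (norm (f y)) \<partial>M) < \<infinity>"
    and "(\<integral>\<^sup>+x. ennreal (enn2real (\<integral>\<^sup>+y. G x y * ennreal (norm (f y)) \<partial>M) powr p) \<partial>M)
      \<le> ennreal ((h * Lp_norm M p f) powr p)"
proof -
  interpret sigma_finite_measure M by fact
  interpret P: pair_sigma_finite M M ..
  note [measurable] = Lp_fun_measurable[OF f]
  define F where "F x = (\<integral>\<^sup>+y. G x y * ennreal (norm (f y)) \<partial>M)" for x
  define P where "P x = (\<integral>\<^sup>+y. G x y * ennreal (norm (f y) powr p) \<partial>M)" for x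
  have [measurable]: "F \<in> borel_measurable M" "P \<in> borel_measurable M"
    unfolding F_def P_def by measurable
  have tangent: "ennreal (p * m powr (p - 1)) * F x \<le> P x + ennreal ((p - 1) * m powr p * h)"
    if "x \<in> space M" "m \<ge> 0" for x m
  proof -
    have [measurable]: "G x \<in> borel_measurable M" using that by measurable
    have "ennreal (p * m powr (p - 1)) * F x
        = (\<integral>\<^sup>+y. G x y * ennreal (p * m powr (p - 1) * norm (f y)) \<partial>M)"
      using p unfolding F_def
      by (subst nn_integral_cmult[symmetric]) (auto simp: ennreal_mult mult_ac)
    also have "\<dots> \<le> (\<integral>\<^sup>+y. G x y * ennreal (norm (f y) powr p)
        + ennreal ((p - 1) * m powr p) * G x y \<partial>M)"
    proof (rule nn_integral_mono)
      fix y
      have "G x y * ennreal (p * m powr (p - 1) * norm (f y))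
          \<le> G x y * ennreal (norm (f y) powr p + (p - 1) * m powr p)"
        using p that by (intro mult_left_mono ennreal_leI powr_tangent) auto
      then show "G x y * ennreal (p * m powr (p - 1) * norm (f y))
          \<le> G x y * ennreal (norm (f y) powr p) + ennreal ((p - 1) * m powr p) * G x y"
        using p by (simp add: distrib_left mult_ac)
    qed
    also have "\<dots> = P x + ennreal ((p - 1) * m powr p) * (\<integral>\<^sup>+y. G x y \<partial>M)"
      by (simp add: nn_integral_add nn_integral_cmult P_def)
    also have "\<dots> \<le> P x + ennreal ((p - 1) * m powr p) * ennreal h"
      using row that by (intro add_left_mono mult_left_mono) auto
    also have "\<dots> = P x + ennreal ((p - 1) * m powr p * h)"
      using p h by (simp add: ennreal_mult)
    finally show ?thesis .
  qed
  \<comment> \<open>The tangent point m = 1 already shows that F is finite wherever P is, so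
    \<open>enn2real\<close> hides an infinite value at most on a null set.\<close>
  have fin: "F x < \<infinity>" if "x \<in> space M" "P x < \<infinity>" for x
  proof -
    have "ennreal p * F x \<le> P x + ennreal ((p - 1) * h)" using tangent[OF that(1), of 1] by simp
    also have "\<dots> < \<infinity>" using that by simp
    finally show ?thesis using p by (auto simp: ennreal_mult_less_top)
  qed
  have le: "ennreal (enn2real (F x) powr p) \<le> ennreal (h powr (p - 1)) * P x"
    if x: "x \<in> space M" for x
  proof (cases "P x < \<infinity>")
    case True
    then obtain \<pi> \<phi> where P: "P x = ennreal \<pi>" "\<pi> \<ge> 0" and F: "F x = ennreal \<phi>" "\<phi> \<ge> 0"
      using fin[OF x True] by (metis ennreal_cases infinity_ennreal_def less_irrefl)
    \<comment> \<open>The tangent point m = F x / h is the optimal one: both powers become the same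
      quantity X = (F x)^p / h^(p - 1), and p X is at most P x + (p - 1) X.\<close>
    have "ennreal (p * (\<phi> / h) powr (p - 1) * \<phi>) \<le> ennreal (\<pi> + (p - 1) * (\<phi> / h) powr p * h)"
      using tangent[OF x, of "\<phi> / h"] h p P F by (simp add: ennreal_mult)
    then have "p * (\<phi> / h) powr (p - 1) * \<phi> \<le> \<pi> + (p - 1) * (\<phi> / h) powr p * h"
      using p h P by (subst (asm) ennreal_le_iff) auto
    moreover define X where "X = \<phi> powr p / h powr (p - 1)"
    have "(\<phi> / h) powr (p - 1) * \<phi> = X" "(\<phi> / h) powr p * h = X"
      using h F by (auto simp: X_def powr_divide powr_diff)
    ultimately have "p * X \<le> \<pi> + (p - 1) * X"
      by (metis mult.assoc)
    then have "X \<le> \<pi>" by (simp add: algebra_simps)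
    then have "\<phi> powr p \<le> h powr (p - 1) * \<pi>" using h by (simp add: X_def field_simps)
    then show ?thesis using F P by (simp add: ennreal_mult[symmetric])
  next
    case False
    then have "ennreal (h powr (p - 1)) * P x = \<infinity>"
      using h by (auto simp: less_top[symmetric] ennreal_mult_top)
    then show ?thesis by simp
  qed
  have "(\<integral>\<^sup>+x. P x \<partial>M) = (\<integral>\<^sup>+y. \<integral>\<^sup>+x. G x y * ennreal (norm (f y) powr p) \<partial>M \<partial>M)"
    unfolding P_def by (rule P.Fubini'[symmetric]) measurable
  also have "\<dots> \<le> (\<integral>\<^sup>+y. ennreal h * ennreal (norm (f y) powr p) \<partial>M)"
    using col by (intro nn_integral_mono) (auto simp: nn_integral_multc intro!: mult_right_mono)
  also have "\<dots> = ennreal (h * Lp_norm M p f powr p)"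
    using h by (simp add: nn_integral_cmult nn_integral_Lp[OF p f] ennreal_mult)
  finally have intP: "(\<integral>\<^sup>+x. P x \<partial>M) \<le> ennreal (h * Lp_norm M p f powr p)" .
  then have "(\<integral>\<^sup>+x. P x \<partial>M) \<noteq> \<infinity>" by (auto simp: top_unique)
  then have "AE x in M. P x \<noteq> \<infinity>" by (intro nn_integral_noteq_infinite) auto
  then show "AE x in M. (\<integral>\<^sup>+y. G x y * ennreal (norm (f y)) \<partial>M) < \<infinity>"
    using AE_space by eventually_elim (use fin in \<open>auto simp: F_def less_top\<close>)
  have "(\<integral>\<^sup>+x. ennreal (enn2real (F x) powr p) \<partial>M) \<le> (\<integral>\<^sup>+x. ennreal (h powr (p - 1)) * P x \<partial>M)"
    using le by (intro nn_integral_mono) auto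
  also have "\<dots> \<le> ennreal (h powr (p - 1)) * ennreal (h * Lp_norm M p f powr p)"
    using intP by (simp add: nn_integral_cmult mult_left_mono)
  also have "\<dots> = ennreal ((h * Lp_norm M p f) powr p)"
    using h by (simp add: ennreal_mult[symmetric] powr_mult powr_diff)
  finally show "(\<integral>\<^sup>+x. ennreal (enn2real (\<integral>\<^sup>+y. G x y * ennreal (norm (f y)) \<partial>M) powr p) \<partial>M)
      \<le> ennreal ((h * Lp_norm M p f) powr p)"
    by (simp add: F_def)
qed

text \<open>Outside the integrable case the Bochner integral is 0 by convention, so no convergence
  needs to be checked beforehand.\<close>

lemma norm_integral_le_nn_integral:
  fixes f :: "'m \<Rightarrow> 'a::{banach, second_countable_topology}"
  shows "ennreal (norm (LINT x|M. f x)) \<le> (\<integral>\<^sup>+x. ennreal (norm (f x)) \<partial>M)"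
  by (cases "integrable M f") (auto simp: integral_norm_bound_ennreal not_integrable_integral_eq)

text \<open>The row and column conditions are put on a measurable majorant rather than on the
  kernel. Its values lie in \<open>ennreal\<close> because the convolution majorant used later may
  be infinite at some points.\<close>

definition Schur_bounded ::
  "'m measure \<Rightarrow> real \<Rightarrow> ('m \<Rightarrow> 'm \<Rightarrow> 'a::{real_normed_field, euclidean_space}) \<Rightarrow> bool" where
  "Schur_bounded M h D \<longleftrightarrow> (\<exists>G. case_prod G \<in> borel_measurable (M \<Otimes>\<^sub>M M) \<and>
     (\<forall>x\<in>space M. \<forall>y\<in>space M. ennreal (norm (D x y)) \<le> G x y) \<and>
     (\<forall>x\<in>space M. (\<integral>\<^sup>+y. G x y \<partial>M) \<le> ennreal h) \<and>
     (\<forall>y\<in>space M. (\<integral>\<^sup>+x. G x y \<partial>M) \<le> ennreal h))"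

text \<open>Domination by G reduces everything to \<open>Schur_test_nn\<close>. The constant h
  bounds the operator norm on every L^p, which is why one approximation of the kernel serves all
  p.\<close>

lemma
  fixes f :: "'m \<Rightarrow> 'a::{real_normed_field, euclidean_space}" and D :: "'m \<Rightarrow> 'm \<Rightarrow> 'a"
  assumes M: "sigma_finite_measure M" and p: "p \<ge> 1" and h: "h > 0"
    and D [measurable]: "case_prod D \<in> borel_measurable (M \<Otimes>\<^sub>M M)"
    and Schur: "Schur_bounded M h D"
    and f: "f \<in> Lp_fun M p"
  shows Schur_test_integrable: "AE x in M. integrable M (\<lambda>y. D x y * f y)"
    and Schur_test_Lp_fun: "(\<lambda>x. LINT y|M. D x y * f y) \<in> Lp_fun M p"
    and Schur_test_Lp_norm: "Lp_norm M p (\<lambda>x. LINT y|M. D x y * f y) \<le> h * Lp_norm M p f"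
proof -
  interpret sigma_finite_measure M by fact
  note [measurable] = Lp_fun_measurable[OF f]
  obtain G where G [measurable]: "case_prod G \<in> borel_measurable (M \<Otimes>\<^sub>M M)"
    and le: "\<And>x y. x \<in> space M \<Longrightarrow> y \<in> space M \<Longrightarrow> ennreal (norm (D x y)) \<le> G x y"
    and row: "\<And>x. x \<in> space M \<Longrightarrow> (\<integral>\<^sup>+y. G x y \<partial>M) \<le> ennreal h"
    and col: "\<And>y. y \<in> space M \<Longrightarrow> (\<integral>\<^sup>+x. G x y \<partial>M) \<le> ennreal h"
    using Schur unfolding Schur_bounded_def by blast
  have nn: "AE x in M. (\<integral>\<^sup>+y. G x y * ennreal (norm (f y)) \<partial>M) < \<infinity>"
      "(\<integral>\<^sup>+x. ennreal (enn2real (\<integral>\<^sup>+y. G x y * ennreal (norm (f y)) \<partial>M) powr p) \<partial>M)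
        \<le> ennreal ((h * Lp_norm M p f) powr p)"
    by (intro Schur_test_nn[OF M p h G _ _ f] row col; assumption)+
  have bound: "(\<integral>\<^sup>+y. ennreal (norm (D x y * f y)) \<partial>M)
      \<le> (\<integral>\<^sup>+y. G x y * ennreal (norm (f y)) \<partial>M)" if "x \<in> space M" for x
    using le that
    by (intro nn_integral_mono) (auto simp: norm_mult ennreal_mult intro!: mult_right_mono)
  from nn(1) AE_space show "AE x in M. integrable M (\<lambda>y. D x y * f y)"
  proof eventually_elim
    case (elim x)
    then have [measurable]: "(\<lambda>y. D x y) \<in> borel_measurable M" by measurable
    show ?case using bound[of x] elim by (intro integrableI_bounded) auto
  qed
  have "(\<integral>\<^sup>+x. ennreal (norm (LINT y|M. D x y * f y) powr p) \<partial>M)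
      \<le> (\<integral>\<^sup>+x. ennreal (enn2real (\<integral>\<^sup>+y. G x y * ennreal (norm (f y)) \<partial>M) powr p) \<partial>M)"
  proof (rule nn_integral_mono_AE)
    from nn(1) AE_space
    show "AE x in M. ennreal (norm (LINT y|M. D x y * f y) powr p)
        \<le> ennreal (enn2real (\<integral>\<^sup>+y. G x y * ennreal (norm (f y)) \<partial>M) powr p)"
    proof eventually_elim
      case (elim x)
      have "ennreal (norm (LINT y|M. D x y * f y)) \<le> (\<integral>\<^sup>+y. G x y * ennreal (norm (f y)) \<partial>M)"
        using norm_integral_le_nn_integral bound[OF elim(2)] by (rule order_trans)
      then have "norm (LINT y|M. D x y * f y)
          \<le> enn2real (\<integral>\<^sup>+y. G x y * ennreal (norm (f y)) \<partial>M)"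
        using elim(1) by (cases "\<integral>\<^sup>+y. G x y * ennreal (norm (f y)) \<partial>M") auto
      then show ?case using p by (intro ennreal_leI powr_mono2) auto
    qed
  qed
  also note nn(2)
  finally have "(\<integral>\<^sup>+x. ennreal (norm (LINT y|M. D x y * f y) powr p) \<partial>M)
      \<le> ennreal ((h * Lp_norm M p f) powr p)" .
  from Lp_funI[OF p _ _ this]
  show "(\<lambda>x. LINT y|M. D x y * f y) \<in> Lp_fun M p"
    and "Lp_norm M p (\<lambda>x. LINT y|M. D x y * f y) \<le> h * Lp_norm M p f"
    using h by auto
qed

section \<open>Approximable kernels\<close>

definition integral_operator ::
  "'m measure \<Rightarrow> ('m \<Rightarrow> 'm \<Rightarrow> 'a) \<Rightarrow> ('m \<Rightarrow> 'a::{real_normed_field, euclidean_space}) \<Rightarrow> 'm \<Rightarrow> 'a" where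
  "integral_operator M K f x = (LINT y|M. K x y * f y)"

text \<open>The net consists of the functions that are constant on the cells of a fine grid, with values
  in a finite net of a ball.\<close>

lemma equicontinuous_kernel_net:
  fixes K :: "real \<Rightarrow> real \<Rightarrow> 'a::{real_normed_field, euclidean_space}"
    and c p :: real
  defines "M \<equiv> segment_measure c"
  assumes c: "c > 0" and p: "p \<ge> 1"
    and [measurable]: "case_prod K \<in> borel_measurable (M \<Otimes>\<^sub>M M)"
    and bound: "\<And>x y. x \<in> {-c..c} \<Longrightarrow> y \<in> {-c..c} \<Longrightarrow> norm (K x y) \<le> C"
    and equi: "\<And>e. e > 0 \<Longrightarrow> \<exists>d>0. \<forall>x\<in>{-c..c}. \<forall>x'\<in>{-c..c}. \<forall>y\<in>{-c..c}.
      \<bar>x - x'\<bar> < d \<longrightarrow> norm (K x y - K x' y) \<le> e"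
    and R: "R \<ge> 0" and e: "e > 0"
  shows "\<exists>G. finite G \<and> G \<subseteq> Lp_fun M p \<and> (\<forall>f\<in>Lp_fun M p. Lp_norm M p f \<le> R \<longrightarrow>
    (\<exists>g\<in>G. Lp_norm M p (\<lambda>x. integral_operator M K f x - g x) < e))"
proof -
  have sp [simp]: "space M = {-c..c}" by (simp add: M_def)
  have fin: "finite_measure M"
    unfolding M_def by (rule finite_measure_lebesgue_on) simp
  interpret finite_measure M by fact
  \<comment> \<open>\<open>Q\<close> bounds the L^1 norm of every f with norm at most R, and
    \<open>w\<close> turns a uniform bound into an L^p bound. A uniform error of 2 * b then costs 2
    * b * w < e; the summands 1 in the denominators avoid division by 0.\<close>
  define Q where "Q = (measure M (space M) + 1) * R"
  define w where "w = measure M (space M) powr (1 / p)"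
  define b where "b = e / (4 * (w + 1))"
  have Q: "Q \<ge> 0" and w: "w \<ge> 0" and b: "b > 0"
    using R e by (auto simp: Q_def w_def b_def intro!: divide_pos_pos add_nonneg_pos)
  obtain d where d: "d > 0" and dK: "\<And>x x' y. x \<in> {-c..c} \<Longrightarrow> x' \<in> {-c..c} \<Longrightarrow> y \<in> {-c..c} \<Longrightarrow>
      \<bar>x - x'\<bar> < d \<Longrightarrow> norm (K x y - K x' y) \<le> b / (Q + 1)"
    using equi[of "b / (Q + 1)"] b Q by (metis add_nonneg_pos divide_pos_pos zero_less_one)
  \<comment> \<open>Left end of the cell of index i on the grid of width d, clipped at -c because
    the first cell may begin to the left of the segment.\<close>
  define node where "node i = max (- c) (d * real_of_int i)" for i
  have node: "node \<lfloor>x / d\<rfloor> \<in> {-c..c}" "\<bar>x - node \<lfloor>x / d\<rfloor>\<bar> < d" if "x \<in> {-c..c}" for x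
  proof -
    have "d * real_of_int \<lfloor>x / d\<rfloor> \<le> x" "x < d * real_of_int \<lfloor>x / d\<rfloor> + d"
      using d floor_divide_lower[of d x] floor_divide_upper[of d x] by (auto simp: algebra_simps)
    then show "node \<lfloor>x / d\<rfloor> \<in> {-c..c}" "\<bar>x - node \<lfloor>x / d\<rfloor>\<bar> < d"
      using that d by (auto simp: node_def)
  qed
  define I where "I = {\<lfloor>- c / d\<rfloor>..\<lfloor>c / d\<rfloor>}"
  have I: "\<lfloor>x / d\<rfloor> \<in> I" if "x \<in> {-c..c}" for x
    using that d divide_right_mono[of "- c" x d] divide_right_mono[of x c d]
    by (auto simp: I_def intro!: floor_mono)
  obtain Z where Z: "finite Z" "cball (0 :: 'a) (C * Q) \<subseteq> (\<Union>z\<in>Z. ball z b)"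
    using seq_compact_imp_totally_bounded[of "cball (0 :: 'a) (C * Q)"] b
    by (metis compact_cball compact_eq_seq_compact_metric)
  \<comment> \<open>The extensional product of the finite sets \<open>I\<close> and \<open>Z\<close>
    is finite, and so is the net. \<open>Z\<close> is a b-net of the ball of radius C * Q that
    contains all values of the images.\<close>
  define G where "G = (\<lambda>z x. z \<lfloor>x / d\<rfloor> :: 'a) ` (I \<rightarrow>\<^sub>E Z)"
  have Kx [measurable]: "(\<lambda>y. K x y) \<in> borel_measurable M" if "x \<in> {-c..c}" for x
    using that by (intro measurable_compose[OF _ \<open>case_prod K \<in> _\<close>, of "\<lambda>y. (x, y)", simplified]) auto
  have G_meas: "(\<lambda>x. z \<lfloor>x / d\<rfloor> :: 'a) \<in> borel_measurable M" for z
  proof -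
    have "(\<lambda>x. z \<lfloor>x / d\<rfloor> :: 'a) \<in> borel_measurable borel"
      by (rule measurable_compose[where N = "count_space UNIV" and g = z]) auto
    then show ?thesis
      unfolding M_def by (intro measurable_restrict_space1 measurable_completion) simp
  qed
  have "G \<subseteq> Lp_fun M p"
  proof
    fix g assume "g \<in> G"
    then obtain z where z: "z \<in> I \<rightarrow>\<^sub>E Z" "g = (\<lambda>x. z \<lfloor>x / d\<rfloor>)" by (auto simp: G_def)
    obtain B where B: "\<And>u. u \<in> Z \<Longrightarrow> norm u \<le> B" "B \<ge> 0"
      using finite_imp_bounded[OF Z(1)] by (metis bounded_pos less_imp_le)
    show "g \<in> Lp_fun M p"
      by (rule Lp_norm_bounded(1)[OF fin p _ B(2)]) (use z G_meas I B in auto)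
  qed
  moreover have "\<exists>g\<in>G. Lp_norm M p (\<lambda>x. integral_operator M K f x - g x) < e"
    if f: "f \<in> Lp_fun M p" "Lp_norm M p f \<le> R" for f
  proof -
    note [measurable] = Lp_fun_measurable[OF f(1)]
    have f1: "integrable M f" by (rule Lp_fun_integrable[OF fin p f(1)])
    have fQ: "(LINT x|M. norm (f x)) \<le> Q"
      using integral_norm_le_Lp_norm[OF fin p f(1)] f(2)
      by (auto simp: Q_def elim!: order_trans intro!: mult_left_mono)
    have le: "norm (LINT y|M. D y * f y) \<le> B * Q"
      if D: "\<And>y. y \<in> {-c..c} \<Longrightarrow> norm (D y) \<le> B" and B: "B \<ge> 0" for D and B
    proof (cases "integrable M (\<lambda>y. D y * f y)")
      case True
      have "norm (LINT y|M. D y * f y) \<le> (LINT y|M. norm (D y * f y))"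
        by (rule integral_norm_bound)
      also have "\<dots> \<le> (LINT y|M. B * norm (f y))"
        using integrable_norm[OF True] f1 D
        by (intro integral_mono) (auto simp: norm_mult intro!: mult_right_mono)
      also have "\<dots> \<le> B * Q" using fQ B by (simp add: mult_left_mono)
      finally show ?thesis .
    qed (use B Q in \<open>simp add: not_integrable_integral_eq\<close>)
    have C: "C \<ge> 0" using bound[of c c] c by (auto intro: order_trans[OF norm_ge_zero])
    have int: "integrable M (\<lambda>y. K x y * f y)" if "x \<in> {-c..c}" for x
    proof (rule Bochner_Integration.integrable_bound)
      show "integrable M (\<lambda>y. C * norm (f y))" using f1 by simp
      show "(\<lambda>y. K x y * f y) \<in> borel_measurable M" using Kx[OF that] by measurable
      show "AE y in M. norm (K x y * f y) \<le> norm (C * norm (f y))"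
        using bound that C by (auto simp: norm_mult intro!: AE_I2 mult_right_mono)
    qed
    have "\<exists>z. z \<in> Z \<and> dist z (integral_operator M K f x) < b" if "x \<in> {-c..c}" for x
    proof -
      have "integral_operator M K f x \<in> cball 0 (C * Q)"
        unfolding integral_operator_def using le[of "K x" C] bound that C by auto
      then have "integral_operator M K f x \<in> (\<Union>z\<in>Z. ball z b)" using Z(2) by blast
      then show ?thesis by auto
    qed
    then obtain z0 where z0: "\<And>x. x \<in> {-c..c} \<Longrightarrow>
        z0 x \<in> Z \<and> dist (z0 x) (integral_operator M K f x) < b" by metis
    have nodeI: "node i \<in> {-c..c}" if "i \<in> I" for i
    proof -
      have "i \<le> \<lfloor>c / d\<rfloor>" using that by (simp add: I_def)
      then have "real_of_int i \<le> c / d" by (simp add: le_floor_iff)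
      then show ?thesis using d c by (auto simp: node_def field_simps)
    qed
    define g where "g x = restrict (\<lambda>i. z0 (node i)) I \<lfloor>x / d\<rfloor>" for x
    have "g \<in> G"
      unfolding G_def
      by (rule image_eqI[of _ _ "restrict (\<lambda>i. z0 (node i)) I"]) (use z0 nodeI in \<open>auto simp: g_def\<close>)
    \<comment> \<open>One b comes from moving x to the node of its cell (equicontinuity), the other
      from rounding the value at the node to a point of \<open>Z\<close>.\<close>
    have close: "norm (integral_operator M K f x - g x) \<le> 2 * b" if x: "x \<in> {-c..c}" for x
    proof -
      let ?n = "node \<lfloor>x / d\<rfloor>"
      have "integral_operator M K f x - integral_operator M K f ?n
          = (LINT y|M. (K x y - K ?n y) * f y)"
        unfolding integral_operator_def
        using int[OF x] int[OF node(1)[OF x]] by (simp add: left_diff_distrib)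
      then have "norm (integral_operator M K f x - integral_operator M K f ?n) \<le> b / (Q + 1) * Q"
        using le[of "\<lambda>y. K x y - K ?n y" "b / (Q + 1)"] dK[OF x node(1)[OF x] _ node(2)[OF x]] b Q
        by auto
      also have "\<dots> \<le> b" using b Q by (simp add: field_simps)
      finally have "norm (integral_operator M K f x - integral_operator M K f ?n) \<le> b" .
      moreover have "norm (integral_operator M K f ?n - g x) \<le> b"
        using z0[OF node(1)[OF x]] I[OF x] by (simp add: g_def dist_norm norm_minus_commute)
      ultimately show ?thesis
        using norm_triangle_ineq[of "integral_operator M K f x - integral_operator M K f ?n"
            "integral_operator M K f ?n - g x"] by simp
    qed
    have "Lp_norm M p (\<lambda>x. integral_operator M K f x - g x) \<le> 2 * b * measure M (space M) powr (1 / p)"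
    proof (rule Lp_norm_bounded(2)[OF fin p])
      have "g \<in> borel_measurable M" unfolding g_def by (rule G_meas)
      then show "(\<lambda>x. integral_operator M K f x - g x) \<in> borel_measurable M"
        unfolding integral_operator_def by measurable
    qed (use b close in auto)
    also have "\<dots> = 2 * b * w" by (simp add: w_def)
    also have "\<dots> < e" using w e by (simp add: b_def field_simps add_pos_nonneg)
    finally show ?thesis using \<open>g \<in> G\<close> by blast
  qed
  moreover have "finite G" unfolding G_def using Z by (intro finite_imageI finite_PiE) (auto simp: I_def)
  ultimately show ?thesis by blast
qed

text \<open>Total boundedness of images survives limits in operator norm: a net for the
  approximating operator is also a net for the given one, up to the Schur bound of the
  difference.\<close>

lemma
  fixes K :: "real \<Rightarrow> real \<Rightarrow> 'a::{real_normed_field, euclidean_space}"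
    and c p :: real
  defines "M \<equiv> segment_measure c"
  assumes c: "c > 0" and p: "p \<ge> 1"
    and K [measurable]: "case_prod K \<in> borel_measurable (M \<Otimes>\<^sub>M M)"
    and approx: "\<And>e. e > 0 \<Longrightarrow> \<exists>K' C. case_prod K' \<in> borel_measurable (M \<Otimes>\<^sub>M M) \<and>
      Schur_bounded M e (\<lambda>x y. K x y - K' x y) \<and>
      (\<forall>x\<in>{-c..c}. \<forall>y\<in>{-c..c}. norm (K' x y) \<le> C) \<and>
      (\<forall>e'>0. \<exists>d>0. \<forall>x\<in>{-c..c}. \<forall>x'\<in>{-c..c}. \<forall>y\<in>{-c..c}.
        \<bar>x - x'\<bar> < d \<longrightarrow> norm (K' x y - K' x' y) \<le> e')"
  shows approximable_kernel_integrable: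
      "f \<in> Lp_fun M p \<Longrightarrow> AE x in M. integrable M (\<lambda>y. K x y * f y)"
    and approximable_kernel_compact: "Lp_compact_operator M p (integral_operator M K)"
proof -
  have sp [simp]: "space M = {-c..c}" by (simp add: M_def)
  have fin: "finite_measure M"
    unfolding M_def by (rule finite_measure_lebesgue_on) simp
  interpret finite_measure M by fact
  have sfin: "sigma_finite_measure M" ..
  \<comment> \<open>The kernel is an approximant bounded by C plus an error of Schur bound 1; a
    constant majorant is admissible because the segment has finite measure.\<close>
  have "\<exists>h>0. Schur_bounded M h K"
  proof -
    obtain K' C where "Schur_bounded M 1 (\<lambda>x y. K x y - K' x y)"
      and C: "\<And>x y. x \<in> {-c..c} \<Longrightarrow> y \<in> {-c..c} \<Longrightarrow> norm (K' x y) \<le> C"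
      using approx[OF zero_less_one] by metis
    then obtain G where [measurable]: "case_prod G \<in> borel_measurable (M \<Otimes>\<^sub>M M)"
      and G: "\<And>x y. x \<in> {-c..c} \<Longrightarrow> y \<in> {-c..c} \<Longrightarrow> ennreal (norm (K x y - K' x y)) \<le> G x y"
        "\<And>x. x \<in> {-c..c} \<Longrightarrow> (\<integral>\<^sup>+y. G x y \<partial>M) \<le> 1" "\<And>y. y \<in> {-c..c} \<Longrightarrow> (\<integral>\<^sup>+x. G x y \<partial>M) \<le> 1"
      unfolding Schur_bounded_def sp ennreal_1 by metis
    define B where "B = max C 0"
    have "ennreal (norm (K x y)) \<le> G x y + ennreal B" if "x \<in> {-c..c}" "y \<in> {-c..c}" for x y
    proof -
      have "ennreal (norm (K x y)) \<le> ennreal (norm (K x y - K' x y) + B)"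
        using norm_triangle_ineq[of "K x y - K' x y" "K' x y"] C[OF that]
        by (intro ennreal_leI) (simp add: B_def)
      also have "\<dots> = ennreal (norm (K x y - K' x y)) + ennreal B" by (simp add: B_def)
      finally show ?thesis using G(1)[OF that] by (meson add_right_mono order_trans)
    qed
    moreover have "(\<integral>\<^sup>+y. G x y + ennreal B \<partial>M) \<le> ennreal (1 + B * measure M (space M))"
      if "x \<in> {-c..c}" for x
    proof -
      have "x \<in> space M" using that by simp
      then have "(\<lambda>y. G x y) \<in> borel_measurable M" by measurable
      then have "(\<integral>\<^sup>+y. G x y + ennreal B \<partial>M) \<le> 1 + ennreal B * emeasure M (space M)"
        using G(2)[OF that] by (simp add: nn_integral_add add_right_mono)
      then show ?thesis by (simp add: emeasure_eq_measure B_def ennreal_mult[symmetric])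
    qed
    moreover have "(\<integral>\<^sup>+x. G x y + ennreal B \<partial>M) \<le> ennreal (1 + B * measure M (space M))"
      if "y \<in> {-c..c}" for y
    proof -
      have "y \<in> space M" using that by simp
      then have "(\<lambda>x. G x y) \<in> borel_measurable M" by measurable
      then have "(\<integral>\<^sup>+x. G x y + ennreal B \<partial>M) \<le> 1 + ennreal B * emeasure M (space M)"
        using G(3)[OF that] by (simp add: nn_integral_add add_right_mono)
      then show ?thesis by (simp add: emeasure_eq_measure B_def ennreal_mult[symmetric])
    qed
    moreover have "1 + B * measure M (space M) > 0" by (simp add: B_def add_pos_nonneg)
    moreover have "(\<lambda>(x, y). G x y + ennreal B) \<in> borel_measurable (M \<Otimes>\<^sub>M M)" by measurable
    ultimately show ?thesis
      unfolding Schur_bounded_def sp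
      by (intro exI[of _ "1 + B * measure M (space M)"] exI[of _ "\<lambda>x y. G x y + ennreal B"] conjI ballI)
        simp_all
  qed
  then obtain h where h: "h > 0" and KS: "Schur_bounded M h K" by blast
  have int: "AE x in M. integrable M (\<lambda>y. K x y * f y)" if "f \<in> Lp_fun M p" for f
    by (rule Schur_test_integrable[OF sfin p h K KS that])
  then show "f \<in> Lp_fun M p \<Longrightarrow> AE x in M. integrable M (\<lambda>y. K x y * f y)" .
  have maps: "integral_operator M K f \<in> Lp_fun M p" if "f \<in> Lp_fun M p" for f
    unfolding integral_operator_def
    by (rule Schur_test_Lp_fun[OF sfin p h K KS that])
  have lin: "Lp_linear_operator M p (integral_operator M K)"
    unfolding Lp_linear_operator_def
  proof (intro conjI ballI impI allI maps)
    fix f g :: "real \<Rightarrow> 'a" and a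
    assume f: "f \<in> Lp_fun M p"
    show "AE x in M. integral_operator M K (\<lambda>t. a * f t) x = a * integral_operator M K f x"
      by (simp add: integral_operator_def mult.left_commute)
    assume g: "g \<in> Lp_fun M p"
    note [measurable] = Lp_fun_measurable[OF f] Lp_fun_measurable[OF g]
    show "AE x in M. integral_operator M K (\<lambda>t. f t + g t) x
        = integral_operator M K f x + integral_operator M K g x"
      using int[OF f] int[OF g]
      by eventually_elim (simp add: integral_operator_def distrib_left)
    assume eq: "AE x in M. f x = g x"
    have "integral_operator M K f x = integral_operator M K g x" if "x \<in> space M" for x
    proof -
      have "(\<lambda>y. K x y) \<in> borel_measurable M" using that by measurable
      then show ?thesis
        unfolding integral_operator_def
        by (intro integral_cong_AE) (use eq in auto)
    qed
    then show "AE x in M. integral_operator M K f x = integral_operator M K g x" by auto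
  qed
  show "Lp_compact_operator M p (integral_operator M K)"
  proof (rule Lp_compact_operatorI[OF fin p lin])
    fix R e :: real assume R: "R > 0" and e: "e > 0"
    \<comment> \<open>On the ball of radius R the two operators then differ by at most e / 2; the
      net of the approximant supplies the other half.\<close>
    define h where "h = e / (2 * R)"
    have h: "h > 0" using R e by (simp add: h_def)
    obtain K' C where K' [measurable]: "case_prod K' \<in> borel_measurable (M \<Otimes>\<^sub>M M)"
      and S: "Schur_bounded M h (\<lambda>x y. K x y - K' x y)"
      and C: "\<forall>x\<in>{-c..c}. \<forall>y\<in>{-c..c}. norm (K' x y) \<le> C"
      and equi: "\<forall>e'>0. \<exists>d>0. \<forall>x\<in>{-c..c}. \<forall>x'\<in>{-c..c}. \<forall>y\<in>{-c..c}.
        \<bar>x - x'\<bar> < d \<longrightarrow> norm (K' x y - K' x' y) \<le> e'"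
      using approx[OF h] by (elim exE conjE) (rule that)
    obtain N where N: "finite N" "N \<subseteq> Lp_fun M p"
      and near: "\<And>f. f \<in> Lp_fun M p \<Longrightarrow> Lp_norm M p f \<le> R \<Longrightarrow>
        \<exists>g\<in>N. Lp_norm M p (\<lambda>x. integral_operator M K' f x - g x) < e / 2"
      using equicontinuous_kernel_net[OF c p K'[unfolded M_def] C[THEN bspec, THEN bspec]
          equi[THEN spec, THEN mp] less_imp_le[OF R] half_gt_zero[OF e]]
      unfolding M_def by blast
    show "\<exists>G. finite G \<and> G \<subseteq> Lp_fun M p \<and> (\<forall>f\<in>Lp_fun M p. Lp_norm M p f \<le> R \<longrightarrow>
        (\<exists>g\<in>G. Lp_norm M p (\<lambda>x. integral_operator M K f x - g x) < e))"
    proof (intro exI[of _ N] conjI N ballI impI)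
      fix f :: "real \<Rightarrow> 'a" assume f: "f \<in> Lp_fun M p" "Lp_norm M p f \<le> R"
      note [measurable] = Lp_fun_measurable[OF f(1)]
      obtain g where g: "g \<in> N" "Lp_norm M p (\<lambda>x. integral_operator M K' f x - g x) < e / 2"
        using near f by blast
      then have gL: "g \<in> Lp_fun M p" using N by auto
      define D where "D x y = K x y - K' x y" for x y
      have D: "case_prod D \<in> borel_measurable (M \<Otimes>\<^sub>M M)" unfolding D_def by measurable
      have DS: "Schur_bounded M h D" using S by (simp add: D_def[abs_def])
      have "Lp_norm M p (\<lambda>x. LINT y|M. D x y * f y) \<le> h * Lp_norm M p f"
        by (rule Schur_test_Lp_norm[OF sfin p h D DS f(1)])
      also have "\<dots> \<le> e / 2" using f R e by (simp add: h_def field_simps)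
      finally have D1: "Lp_norm M p (\<lambda>x. LINT y|M. D x y * f y) \<le> e / 2" .
      have DL: "(\<lambda>x. LINT y|M. D x y * f y) \<in> Lp_fun M p"
        by (rule Schur_test_Lp_fun[OF sfin p h D DS f(1)])
      have DI: "AE x in M. integrable M (\<lambda>y. D x y * f y)"
        by (rule Schur_test_integrable[OF sfin p h D DS f(1)])
      have eq: "AE x in M. integral_operator M K f x - integral_operator M K' f x
          = (LINT y|M. D x y * f y)"
        using DI int[OF f(1)]
      proof eventually_elim
        case (elim x)
        have "K' x y * f y = K x y * f y - D x y * f y" for y by (simp add: D_def algebra_simps)
        then show ?case using elim by (simp add: integral_operator_def)
      qed
      have [measurable]: "integral_operator M K' f \<in> borel_measurable M"
          "integral_operator M K f \<in> borel_measurable M"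
        unfolding integral_operator_def by measurable
      have "Lp_norm M p (\<lambda>x. integral_operator M K f x - integral_operator M K' f x) \<le> e / 2"
        using D1 Lp_norm_cong_AE[OF _ _ eq, of p] Lp_fun_measurable[OF DL] by auto
      moreover have "(\<lambda>x. integral_operator M K f x - integral_operator M K' f x) \<in> Lp_fun M p"
        using Lp_fun_cong_AE[OF DL, of "\<lambda>x. integral_operator M K f x - integral_operator M K' f x"] eq
        by (auto simp: eq_commute)
      then have "integral_operator M K' f \<in> Lp_fun M p"
        using Lp_fun_diff[OF p maps[OF f(1)]] by force
      ultimately have "Lp_norm M p (\<lambda>x. integral_operator M K f x - g x) < e"
        using Lp_norm_diff_triangle[OF p maps[OF f(1)] _ gL, of "integral_operator M K' f"] g(2) by auto
      then show "\<exists>g\<in>N. Lp_norm M p (\<lambda>x. integral_operator M K f x - g x) < e" using g by blast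
    qed
  qed
qed

section \<open>Borel representatives and continuous approximation\<close>

text \<open>Borel functions can be composed with differences of variables on product spaces. The
  real-valued representative is taken for each coordinate, and the finitely many exceptional null
  sets are united.\<close>

lemma lebesgue_on_ex_borel_measurable:
  fixes f :: "'b::euclidean_space \<Rightarrow> 'a::euclidean_space"
  assumes f: "f \<in> borel_measurable (lebesgue_on S)" and S: "S \<in> sets borel"
  obtains g where "g \<in> borel_measurable borel" "\<And>x. x \<notin> S \<Longrightarrow> g x = 0"
    "AE x in lborel. x \<in> S \<longrightarrow> g x = f x"
proof -
  define F where "F x = (if x \<in> S then f x else 0)" for x
  have F: "F \<in> borel_measurable lebesgue"
    unfolding F_def using f S by (intro borel_measurable_if_I) auto
  have "\<exists>h\<in>borel_measurable lborel. AE x in lborel. F x \<bullet> b = h x" for b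
    using F by (intro completion_ex_borel_measurable_real borel_measurable_inner) auto
  then obtain h where h: "\<And>b. h b \<in> borel_measurable lborel" "\<And>b. AE x in lborel. F x \<bullet> b = h b x"
    by metis
  define g where "g x = (if x \<in> S then (\<Sum>b\<in>Basis. h b x *\<^sub>R b) else 0)" for x
  have [measurable]: "h b \<in> borel_measurable borel" for b using h(1) by simp
  have "AE x in lborel. \<forall>b\<in>Basis. F x \<bullet> b = h b x"
    by (rule AE_finite_allI) (auto intro: h(2))
  then have "AE x in lborel. x \<in> S \<longrightarrow> g x = f x"
  proof eventually_elim
    case (elim x)
    then have "(\<Sum>b\<in>Basis. h b x *\<^sub>R b) = (\<Sum>b\<in>Basis. (F x \<bullet> b) *\<^sub>R b)"
      by (intro sum.cong) auto
    then show ?case by (simp add: g_def F_def euclidean_representation)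
  qed
  moreover have "g \<in> borel_measurable borel"
    unfolding g_def using S by measurable
  ultimately show thesis by (intro that[of g]) (auto simp: g_def)
qed

text \<open>Density in L^1 by induction over integrable functions: indicators, sums, dominated
  limits. An indicator is replaced by a Urysohn function between a closed set inside A and an open
  set around it. Boundedness is carried along since the approximating kernels must be
  bounded.\<close>

lemma integrable_approx_continuous:
  fixes f :: "'b::euclidean_space \<Rightarrow> 'a::euclidean_space"
  assumes "integrable lborel f" "e > 0"
  shows "\<exists>g. continuous_on UNIV g \<and> bounded (range g) \<and> integrable lborel g \<and>
    (LINT x|lborel. norm (f x - g x)) < e"
  using assms
proof (induction arbitrary: e rule: integrable_induct)
  case (base A v)
  have A: "A \<in> sets borel" and AL: "A \<in> sets lebesgue" using base by auto
  \<comment> \<open>The error is at most |v| on T - S, a set of measure below 2 * d, and 2 * d * |v|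
    < e.\<close>
  define d where "d = e / (2 * (norm v + 1))"
  have d: "d > 0" using base by (auto simp: d_def intro!: divide_pos_pos add_nonneg_pos)
  obtain T where T: "open T" "A \<subseteq> T" "emeasure lebesgue (T - A) < ennreal d"
    using sets_lebesgue_outer_open[OF AL d] by metis
  obtain S where S: "closed S" "S \<subseteq> A" "emeasure lebesgue (A - S) < ennreal d"
    using sets_lebesgue_inner_closed[OF AL d] by metis
  have "closed (- T)" "S \<inter> - T = {}" using T S by auto
  with S(1) obtain u where u: "continuous_on UNIV u" "\<And>x. u x \<in> closed_segment (1::real) 0"
      "\<And>x. x \<in> S \<Longrightarrow> u x = 1" "\<And>x. x \<in> - T \<Longrightarrow> u x = 0"
    by (rule Urysohn) blast
  have u01: "0 \<le> u x" "u x \<le> 1" for x using u(2)[of x] by (auto simp: closed_segment_eq_real_ivl)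
  have [measurable]: "u \<in> borel_measurable borel"
    using u(1) by (rule borel_measurable_continuous_onI)
  have [measurable]: "T \<in> sets borel" "S \<in> sets borel" using S T by auto
  have TA: "emeasure lborel (T - A) < ennreal d" and AS: "emeasure lborel (A - S) < ennreal d"
    using T S A by auto
  have "emeasure lborel T \<le> emeasure lborel (T - A) + emeasure lborel A"
    using A T by (intro order_trans[OF _ emeasure_subadditive] emeasure_mono) auto
  also have "\<dots> < \<infinity>" using TA base by (auto simp: less_top intro: order_less_trans)
  finally have intT: "integrable lborel (\<lambda>x. indicator T x :: real)"
    by (simp add: integrable_indicator_iff)
  have "emeasure lborel (T - S) \<le> emeasure lborel (T - A) + emeasure lborel (A - S)"
    using A T S by (intro order_trans[OF _ emeasure_subadditive] emeasure_mono) auto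
  also have "\<dots> < ennreal d + ennreal d" using TA AS by (rule add_strict_mono)
  also have "\<dots> = ennreal (2 * d)" using d by (simp add: ennreal_plus[symmetric] del: ennreal_plus)
  finally have TS: "emeasure lborel (T - S) < ennreal (2 * d)" .
  then have intTS: "integrable lborel (\<lambda>x. indicator (T - S) x :: real)"
    by (simp add: integrable_indicator_iff) (use less_trans[OF TS ennreal_less_top] in auto)
  have uint: "integrable lborel u"
    by (rule Bochner_Integration.integrable_bound[OF intT])
       (use u01 u(4) in \<open>auto simp: indicator_def\<close>)
  have "(LINT x|lborel. norm (indicator A x *\<^sub>R v - u x *\<^sub>R v))
      \<le> (LINT x|lborel. indicator (T - S) x * norm v)"
  proof (rule integral_mono)
    show "integrable lborel (\<lambda>x. norm (indicator A x *\<^sub>R v - u x *\<^sub>R v))"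
      using base uint by (intro integrable_norm Bochner_Integration.integrable_diff) auto
    fix x
    have "\<bar>indicator A x - u x\<bar> \<le> indicator (T - S) x"
      using u01[of x] u(3,4)[of x] T S by (auto simp: indicator_def)
    then show "norm (indicator A x *\<^sub>R v - u x *\<^sub>R v) \<le> indicator (T - S) x * norm v"
      by (simp add: scaleR_diff_left[symmetric] mult_right_mono)
  qed (use intTS in auto)
  also have "\<dots> = measure lborel (T - S) * norm v" by simp
  also have "\<dots> \<le> 2 * d * norm v"
    using TS d by (intro mult_right_mono) (auto simp: measure_def intro!: enn2real_leI)
  also have "\<dots> < e" using base(3) by (simp add: d_def field_simps add_pos_nonneg)
  finally have "(LINT x|lborel. norm (indicator A x *\<^sub>R v - u x *\<^sub>R v)) < e" .
  moreover have "continuous_on UNIV (\<lambda>x. u x *\<^sub>R v)" by (intro continuous_intros u)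
  moreover have "bounded (range (\<lambda>x. u x *\<^sub>R v))"
    using u01 by (intro boundedI[of _ "norm v"]) (auto intro!: mult_left_le_one_le)
  ultimately show ?case using uint by (intro exI[of _ "\<lambda>x. u x *\<^sub>R v"]) auto
next
  case (add f1 f2)
  obtain g1 where g1: "continuous_on UNIV g1" "bounded (range g1)" "integrable lborel g1"
      "(LINT x|lborel. norm (f1 x - g1 x)) < e / 2" using add(3)[of "e / 2"] add(5) by auto
  obtain g2 where g2: "continuous_on UNIV g2" "bounded (range g2)" "integrable lborel g2"
      "(LINT x|lborel. norm (f2 x - g2 x)) < e / 2" using add(4)[of "e / 2"] add(5) by auto
  have "(LINT x|lborel. norm (f1 x + f2 x - (g1 x + g2 x)))
      \<le> (LINT x|lborel. norm (f1 x - g1 x) + norm (f2 x - g2 x))"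
    using add(1,2) g1(3) g2(3) by (intro integral_mono) (auto intro: norm_diff_triangle_ineq)
  also have "\<dots> < e" using add(1,2) g1 g2 by simp
  finally have "(LINT x|lborel. norm (f1 x + f2 x - (g1 x + g2 x))) < e" .
  moreover have "bounded (range (\<lambda>x. g1 x + g2 x))"
    using g1(2) g2(2) by (rule bounded_plus_comp)
  ultimately show ?case
    using g1 g2 by (intro exI[of _ "\<lambda>x. g1 x + g2 x"]) (auto intro: continuous_intros)
next
  case (lim f s)
  have "(\<lambda>i. LINT x|lborel. norm (f x - s i x)) \<longlonglongrightarrow> integral\<^sup>L lborel (\<lambda>x :: 'b. 0 :: real)"
  proof (rule integral_dominated_convergence[where w = "\<lambda>x. 3 * norm (f x)"])
    show "AE x in lborel. (\<lambda>i. norm (f x - s i x)) \<longlonglongrightarrow> 0"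
    proof (intro AE_I2 tendsto_norm_zero)
      fix x :: 'b
      have "(\<lambda>i. f x - s i x) \<longlonglongrightarrow> f x - f x"
        by (intro tendsto_diff tendsto_const lim(2)) simp
      then show "(\<lambda>i. f x - s i x) \<longlonglongrightarrow> 0" by simp
    qed
    \<comment> \<open>The induction provides |s i x| at most 2 |f x|, whence the factor 3.\<close>
    show "AE x in lborel. norm (norm (f x - s i x)) \<le> 3 * norm (f x)" for i
    proof (intro AE_I2)
      fix x :: 'b assume "x \<in> space lborel"
      from lim(3)[OF this, of i] show "norm (norm (f x - s i x)) \<le> 3 * norm (f x)"
        using norm_triangle_ineq4[of "f x" "s i x"] by simp
    qed
  qed (use lim(1,4) in auto)
  then have "\<forall>\<^sub>F i in sequentially. (LINT x|lborel. norm (f x - s i x)) < e / 2"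
    using lim(6) by (intro order_tendstoD(2)[where y = 0]) auto
  then obtain i where i: "(LINT x|lborel. norm (f x - s i x)) < e / 2"
    by (auto simp: eventually_sequentially)
  obtain g where g: "continuous_on UNIV g" "bounded (range g)" "integrable lborel g"
      "(LINT x|lborel. norm (s i x - g x)) < e / 2" using lim(5)[of "e / 2" i] lim(6) by auto
  have "(LINT x|lborel. norm (f x - g x))
      \<le> (LINT x|lborel. norm (f x - s i x) + norm (s i x - g x))"
    using lim(1,4) g(3) by (intro integral_mono) (auto intro: norm_triangle_le_diff norm_diff_triangle_le)
  also have "\<dots> < e" using lim(1,4) g i by simp
  finally show ?case using g by blast
qed

section \<open>The integral over the half-line\<close>

text \<open>The factors at \<open>x - t\<close> are kept separate from those at \<open>t - y\<close> because only the former get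
  approximated.\<close>

definition half_line_integrand ::
  "(real \<Rightarrow> 'a::{real_normed_field, euclidean_space}) \<Rightarrow> (real \<Rightarrow> 'a) \<Rightarrow> (real \<Rightarrow> 'a) \<Rightarrow> (real \<Rightarrow> 'a) \<Rightarrow> 'a
    \<Rightarrow> real \<Rightarrow> real \<Rightarrow> real \<Rightarrow> 'a" where
  "half_line_integrand m1 m2 n1 n2 r x y t =
     indicator {..0} t *\<^sub>R ((n1 (t - y) * m2 (x - t) - n2 (t - y) * m1 (x - t)) / r)"

definition half_line_kernel ::
  "(real \<Rightarrow> 'a::{real_normed_field, euclidean_space}) \<Rightarrow> (real \<Rightarrow> 'a) \<Rightarrow> (real \<Rightarrow> 'a) \<Rightarrow> (real \<Rightarrow> 'a) \<Rightarrow> 'a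
    \<Rightarrow> real \<Rightarrow> real \<Rightarrow> 'a" where
  "half_line_kernel m1 m2 n1 n2 r x y = (LINT t|lborel. half_line_integrand m1 m2 n1 n2 r x y t)"

text \<open>The convolutions |n1| * |m2| and |n2| * |m1|, added and divided by |r|. The cut-off at 0
  is dropped, so that the majorant depends on x - y alone.\<close>

definition half_line_majorant ::
  "(real \<Rightarrow> 'a::{real_normed_field, euclidean_space}) \<Rightarrow> (real \<Rightarrow> 'a) \<Rightarrow> (real \<Rightarrow> 'a) \<Rightarrow> (real \<Rightarrow> 'a) \<Rightarrow> 'a
    \<Rightarrow> real \<Rightarrow> ennreal" where
  "half_line_majorant m1 m2 n1 n2 r w = ennreal (1 / norm r) *
     (\<integral>\<^sup>+s. ennreal (norm (n1 s)) * ennreal (norm (m2 (w - s)))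
        + ennreal (norm (n2 s)) * ennreal (norm (m1 (w - s))) \<partial>lborel)"

lemma nn_integral_shift:
  fixes f :: "real \<Rightarrow> ennreal"
  assumes "f \<in> borel_measurable borel"
  shows "(\<integral>\<^sup>+x. f (x - a) \<partial>lborel) = (\<integral>\<^sup>+x. f x \<partial>lborel)"
    and "(\<integral>\<^sup>+x. f (a - x) \<partial>lborel) = (\<integral>\<^sup>+x. f x \<partial>lborel)"
  using nn_integral_real_affine[OF assms, of 1 "-a"] nn_integral_real_affine[OF assms, of "-1" a]
  by simp_all

lemma borel_measurable_half_line_integrand [measurable]:
  assumes [measurable]: "m1 \<in> borel_measurable borel" "m2 \<in> borel_measurable borel"
    "n1 \<in> borel_measurable borel" "n2 \<in> borel_measurable borel"
    "X \<in> borel_measurable N" "Y \<in> borel_measurable N" "T \<in> borel_measurable N"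
  shows "(\<lambda>u. half_line_integrand m1 m2 n1 n2 r (X u) (Y u) (T u)) \<in> borel_measurable N"
  unfolding half_line_integrand_def by measurable

lemma borel_measurable_half_line_kernel:
  assumes [measurable]: "m1 \<in> borel_measurable borel" "m2 \<in> borel_measurable borel"
    "n1 \<in> borel_measurable borel" "n2 \<in> borel_measurable borel"
    "X \<in> borel_measurable N" "Y \<in> borel_measurable N"
  shows "(\<lambda>u. half_line_kernel m1 m2 n1 n2 r (X u) (Y u)) \<in> borel_measurable N"
  unfolding half_line_kernel_def by measurable

lemma borel_measurable_half_line_majorant [measurable]:
  assumes [measurable]: "m1 \<in> borel_measurable borel" "m2 \<in> borel_measurable borel"
    "n1 \<in> borel_measurable borel" "n2 \<in> borel_measurable borel"
    "W \<in> borel_measurable N"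
  shows "(\<lambda>u. half_line_majorant m1 m2 n1 n2 r (W u)) \<in> borel_measurable N"
  unfolding half_line_majorant_def by measurable

context
  fixes m1 m2 n1 n2 :: "real \<Rightarrow> 'a::{real_normed_field, euclidean_space}" and r :: 'a
  assumes m [measurable]: "m1 \<in> borel_measurable borel" "m2 \<in> borel_measurable borel"
    and n: "integrable lborel n1" "integrable lborel n2"
begin

lemma norm_half_line_integrand_le:
  "ennreal (norm (half_line_integrand m1 m2 n1 n2 r x y t))
    \<le> ennreal (1 / norm r) * (ennreal (norm (n1 (t - y))) * ennreal (norm (m2 (x - t)))
      + ennreal (norm (n2 (t - y))) * ennreal (norm (m1 (x - t))))"
proof -
  have "norm (half_line_integrand m1 m2 n1 n2 r x y t)
      \<le> norm (n1 (t - y) * m2 (x - t) - n2 (t - y) * m1 (x - t)) / norm r"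
    by (auto simp: half_line_integrand_def norm_divide indicator_def)
  also have "\<dots> \<le> (norm (n1 (t - y) * m2 (x - t)) + norm (n2 (t - y) * m1 (x - t))) / norm r"
    by (intro divide_right_mono norm_triangle_ineq4) auto
  also have "\<dots> = 1 / norm r * (norm (n1 (t - y)) * norm (m2 (x - t)) + norm (n2 (t - y)) * norm (m1 (x - t)))"
    by (simp add: norm_mult)
  finally have le: "ennreal (norm (half_line_integrand m1 m2 n1 n2 r x y t)) \<le> ennreal (1 / norm r
      * (norm (n1 (t - y)) * norm (m2 (x - t)) + norm (n2 (t - y)) * norm (m1 (x - t))))"
    by (rule ennreal_leI)
  have "ennreal (a * (b * d + b' * d')) = ennreal a
      * (ennreal b * ennreal d + ennreal b' * ennreal d')"
    if "a \<ge> 0" "b \<ge> 0" "d \<ge> 0" "b' \<ge> 0" "d' \<ge> 0" for a b d b' d' :: real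
    using that by (simp add: ennreal_mult)
  from le this[of "1 / norm r" "norm (n1 (t - y))" "norm (m2 (x - t))" "norm (n2 (t - y))" "norm (m1 (x - t))"]
  show ?thesis by (simp only: norm_ge_zero divide_nonneg_nonneg zero_le_one simp_thms)
qed

text \<open>Without the cut-off, the translation s = t - y leaves x and y only in the combination x
  - y.\<close>

lemma nn_integral_half_line_integrand_le:
  "(\<integral>\<^sup>+t. ennreal (norm (half_line_integrand m1 m2 n1 n2 r x y t)) \<partial>lborel)
    \<le> half_line_majorant m1 m2 n1 n2 r (x - y)"
proof -
  note [measurable] = n[THEN borel_measurable_integrable, simplified]
  have "(\<integral>\<^sup>+t. ennreal (norm (half_line_integrand m1 m2 n1 n2 r x y t)) \<partial>lborel)
      \<le> (\<integral>\<^sup>+t. ennreal (1 / norm r) * (ennreal (norm (n1 (t - y))) * ennreal (norm (m2 (x - t)))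
        + ennreal (norm (n2 (t - y))) * ennreal (norm (m1 (x - t)))) \<partial>lborel)"
    by (intro nn_integral_mono norm_half_line_integrand_le)
  also have "\<dots> = (\<integral>\<^sup>+t. (\<lambda>s. ennreal (1 / norm r) * (ennreal (norm (n1 s)) * ennreal (norm (m2 (x - y - s)))
        + ennreal (norm (n2 s)) * ennreal (norm (m1 (x - y - s))))) (t - y) \<partial>lborel)"
    by (simp add: algebra_simps)
  also have "\<dots> = half_line_majorant m1 m2 n1 n2 r (x - y)"
    by (subst nn_integral_shift(1)) (auto simp: half_line_majorant_def nn_integral_cmult)
  finally show ?thesis .
qed

lemma norm_half_line_kernel_le:
  "ennreal (norm (half_line_kernel m1 m2 n1 n2 r x y)) \<le> half_line_majorant m1 m2 n1 n2 r (x - y)"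
  unfolding half_line_kernel_def
  using norm_integral_le_nn_integral nn_integral_half_line_integrand_le by (rule order_trans)

lemma integrable_half_line_integrand:
  assumes "half_line_majorant m1 m2 n1 n2 r (x - y) < \<infinity>"
  shows "integrable lborel (half_line_integrand m1 m2 n1 n2 r x y)"
proof (rule integrableI_bounded)
  note [measurable] = n[THEN borel_measurable_integrable, simplified]
  show "half_line_integrand m1 m2 n1 n2 r x y \<in> borel_measurable lborel" by measurable
  show "(\<integral>\<^sup>+t. ennreal (norm (half_line_integrand m1 m2 n1 n2 r x y t)) \<partial>lborel) < \<infinity>"
    using nn_integral_half_line_integrand_le assms by (rule le_less_trans)
qed

text \<open>For bounded m1, m2 the majorant is finite at every point, so the integrals of the
  approximating kernel converge everywhere and not just almost everywhere.\<close>

lemma half_line_majorant_bounded: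
  assumes B: "\<And>x. norm (m1 x) \<le> B" "\<And>x. norm (m2 x) \<le> B"
  shows "half_line_majorant m1 m2 n1 n2 r w
    \<le> ennreal (B * ((LINT s|lborel. norm (n1 s)) + (LINT s|lborel. norm (n2 s))) / norm r)"
proof -
  note [measurable] = n[THEN borel_measurable_integrable, simplified]
  have B0: "B \<ge> 0" using B(1)[of 0] by (auto intro: order_trans[OF norm_ge_zero])
  have "half_line_majorant m1 m2 n1 n2 r w \<le> ennreal (1 / norm r) *
     (\<integral>\<^sup>+s. ennreal (norm (n1 s)) * ennreal B + ennreal (norm (n2 s)) * ennreal B \<partial>lborel)"
    unfolding half_line_majorant_def
    by (intro mult_left_mono nn_integral_mono add_mono ennreal_leI B) auto
  also have "\<dots> = ennreal (1 / norm r) * (ennreal (LINT s|lborel. norm (n1 s)) * ennreal B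
      + ennreal (LINT s|lborel. norm (n2 s)) * ennreal B)"
    using n by (simp add: nn_integral_add nn_integral_multc nn_integral_eq_integral)
  also have "\<dots> = ennreal (1 / norm r *
      ((LINT s|lborel. norm (n1 s)) * B + (LINT s|lborel. norm (n2 s)) * B))"
    using B0 by (simp add: ennreal_mult[symmetric] ennreal_plus[symmetric] integral_nonneg_AE
        del: ennreal_plus)
  also have "\<dots> = ennreal (B * ((LINT s|lborel. norm (n1 s)) + (LINT s|lborel. norm (n2 s))) / norm r)"
    by (simp add: algebra_simps add_divide_distrib)
  finally show ?thesis .
qed

text \<open>Tonelli and translation invariance: the L^1 norm of a convolution of nonnegative
  functions is the product of the norms. Being linear in the norms of m1 and m2, the value is small
  when these are.\<close>

lemma nn_integral_half_line_majorant:
  assumes mi: "integrable lborel m1" "integrable lborel m2"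
  shows "(\<integral>\<^sup>+w. half_line_majorant m1 m2 n1 n2 r w \<partial>lborel)
    = ennreal (((LINT s|lborel. norm (n1 s)) * (LINT s|lborel. norm (m2 s))
      + (LINT s|lborel. norm (n2 s)) * (LINT s|lborel. norm (m1 s))) / norm r)"
proof -
  note [measurable] = n[THEN borel_measurable_integrable, simplified]
  have conv: "(\<integral>\<^sup>+w. \<integral>\<^sup>+s. ennreal (norm (n s)) * ennreal (norm (m (w - s))) \<partial>lborel \<partial>lborel)
      = ennreal ((LINT s|lborel. norm (n s)) * (LINT s|lborel. norm (m s)))"
    if i: "integrable lborel n" "integrable lborel m" for n m :: "real \<Rightarrow> 'a"
  proof -
    note [measurable] = i[THEN borel_measurable_integrable, simplified]
    have "(\<integral>\<^sup>+w. \<integral>\<^sup>+s. ennreal (norm (n s)) * ennreal (norm (m (w - s))) \<partial>lborel \<partial>lborel)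
        = (\<integral>\<^sup>+s. \<integral>\<^sup>+w. ennreal (norm (n s)) * ennreal (norm (m (w - s))) \<partial>lborel \<partial>lborel)"
      by (rule lborel_pair.Fubini') measurable
    also have "\<dots> = (\<integral>\<^sup>+s. ennreal (norm (n s)) * (\<integral>\<^sup>+w. ennreal (norm (m w)) \<partial>lborel) \<partial>lborel)"
      by (simp add: nn_integral_cmult nn_integral_shift(1)[of "\<lambda>w. ennreal (norm (m w))"])
    also have "\<dots> = ennreal (LINT s|lborel. norm (n s)) * ennreal (LINT s|lborel. norm (m s))"
      using i by (simp add: nn_integral_multc nn_integral_eq_integral)
    finally show ?thesis by (simp add: ennreal_mult integral_nonneg_AE)
  qed
  have "(\<integral>\<^sup>+w. half_line_majorant m1 m2 n1 n2 r w \<partial>lborel) = ennreal (1 / norm r) *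
      ((\<integral>\<^sup>+w. \<integral>\<^sup>+s. ennreal (norm (n1 s)) * ennreal (norm (m2 (w - s))) \<partial>lborel \<partial>lborel)
      + (\<integral>\<^sup>+w. \<integral>\<^sup>+s. ennreal (norm (n2 s)) * ennreal (norm (m1 (w - s))) \<partial>lborel \<partial>lborel))"
    unfolding half_line_majorant_def by (simp add: nn_integral_cmult nn_integral_add)
  also have "\<dots> = ennreal (1 / norm r * ((LINT s|lborel. norm (n1 s)) * (LINT s|lborel. norm (m2 s))
      + (LINT s|lborel. norm (n2 s)) * (LINT s|lborel. norm (m1 s))))"
    unfolding conv[OF n(1) mi(2)] conv[OF n(2) mi(1)]
    by (simp add: ennreal_mult[symmetric] ennreal_plus[symmetric] integral_nonneg_AE
        del: ennreal_plus)
  finally show ?thesis by simp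
qed

end

lemma half_line_integrand_diff:
  "half_line_integrand m1 m2 n1 n2 r x y t - half_line_integrand m1' m2' n1 n2 r x y t
    = half_line_integrand (\<lambda>s. m1 s - m1' s) (\<lambda>s. m2 s - m2' s) n1 n2 r x y t"
proof -
  have "n1 (t - y) * m2 (x - t) - n2 (t - y) * m1 (x - t)
      - (n1 (t - y) * m2' (x - t) - n2 (t - y) * m1' (x - t))
      = n1 (t - y) * (m2 (x - t) - m2' (x - t)) - n2 (t - y) * (m1 (x - t) - m1' (x - t))"
    by (simp add: algebra_simps)
  then show ?thesis
    unfolding half_line_integrand_def scaleR_diff_right[symmetric] diff_divide_distrib[symmetric] by simp
qed

text \<open>Reflection and translation preserve Lebesgue measure, so rows and columns of H(x - y)
  have the same total integral; restriction to S can only decrease it.\<close>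

lemma Schur_bounded_convolution:
  fixes D :: "real \<Rightarrow> real \<Rightarrow> 'a::{real_normed_field, euclidean_space}" and H :: "real \<Rightarrow> ennreal"
  assumes S: "S \<in> sets lebesgue" and H [measurable]: "H \<in> borel_measurable borel"
    and le: "\<And>x y. ennreal (norm (D x y)) \<le> H (x - y)"
    and int: "(\<integral>\<^sup>+w. H w \<partial>lborel) \<le> ennreal h"
  shows "Schur_bounded (lebesgue_on S) h D"
proof -
  \<comment> \<open>Regarded as a map into the Borel line, the identity carries Borel measurability
    of H over to the product of the two Lebesgue spaces.\<close>
  have id: "(\<lambda>x. x) \<in> lebesgue_on S \<rightarrow>\<^sub>M borel"
    by (intro measurable_restrict_space1 measurable_completion) simp
  have "(\<lambda>p. fst p - snd p :: real) \<in> lebesgue_on S \<Otimes>\<^sub>M lebesgue_on S \<rightarrow>\<^sub>M borel"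
    by (intro borel_measurable_diff measurable_compose[OF measurable_fst id]
        measurable_compose[OF measurable_snd id])
  from measurable_compose[OF this H]
  have meas: "(\<lambda>(x, y). H (x - y)) \<in> borel_measurable (lebesgue_on S \<Otimes>\<^sub>M lebesgue_on S)"
    unfolding case_prod_beta' .
  have restrict: "(\<integral>\<^sup>+x. f x \<partial>lebesgue_on S) \<le> (\<integral>\<^sup>+x. f x \<partial>lborel)" for f :: "real \<Rightarrow> ennreal"
  proof -
    have "(\<integral>\<^sup>+x. f x \<partial>lebesgue_on S) = (\<integral>\<^sup>+x. f x * indicator S x \<partial>lebesgue)"
      using S by (intro nn_integral_restrict_space) simp
    also have "\<dots> \<le> (\<integral>\<^sup>+x. f x \<partial>lebesgue)"
      by (intro nn_integral_mono) (auto simp: indicator_def)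
    finally show ?thesis by (simp add: nn_integral_completion)
  qed
  have row: "(\<integral>\<^sup>+y. H (x - y) \<partial>lebesgue_on S) \<le> ennreal h" for x
    using order_trans[OF restrict int[folded nn_integral_shift(2)[OF H, of x]]] .
  have col: "(\<integral>\<^sup>+x. H (x - y) \<partial>lebesgue_on S) \<le> ennreal h" for y
    using order_trans[OF restrict int[folded nn_integral_shift(1)[OF H, of y]]] .
  show ?thesis
    unfolding Schur_bounded_def
    by (rule exI[of _ "\<lambda>x y. H (x - y)"]) (intro conjI ballI meas le row col)
qed

text \<open>The difference of the integrals is the integral of the difference only under
  convergence. The bounded kernel converges everywhere; where the majorant of the difference is
  finite, the other one converges too, and where it is infinite the bound is trivial.\<close>

lemma half_line_kernel_diff_le:
  fixes m1 m2 n1 n2 :: "real \<Rightarrow> 'a::{real_normed_field, euclidean_space}"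
  assumes m [measurable]: "m1 \<in> borel_measurable borel" "m2 \<in> borel_measurable borel"
    and m' [measurable]: "m1' \<in> borel_measurable borel" "m2' \<in> borel_measurable borel"
    and n: "integrable lborel n1" "integrable lborel n2"
    and B: "\<And>x. norm (m1' x) \<le> B" "\<And>x. norm (m2' x) \<le> B"
  shows "ennreal (norm (half_line_kernel m1 m2 n1 n2 r x y - half_line_kernel m1' m2' n1 n2 r x y))
    \<le> half_line_majorant (\<lambda>s. m1 s - m1' s) (\<lambda>s. m2 s - m2' s) n1 n2 r (x - y)"
    (is "_ \<le> ?H")
proof (cases "?H < \<infinity>")
  case True
  have dm: "(\<lambda>s. m1 s - m1' s) \<in> borel_measurable borel" "(\<lambda>s. m2 s - m2' s) \<in> borel_measurable borel"
    by measurable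
  have D: "integrable lborel (half_line_integrand (\<lambda>s. m1 s - m1' s) (\<lambda>s. m2 s - m2' s) n1 n2 r x y)"
    by (rule integrable_half_line_integrand[OF dm n True])
  have "half_line_majorant m1' m2' n1 n2 r (x - y) < \<infinity>"
    using half_line_majorant_bounded[OF m' n B] by (rule le_less_trans) simp
  then have I': "integrable lborel (half_line_integrand m1' m2' n1 n2 r x y)"
    by (rule integrable_half_line_integrand[OF m' n])
  have "half_line_integrand m1 m2 n1 n2 r x y = (\<lambda>t. half_line_integrand m1' m2' n1 n2 r x y t
      + half_line_integrand (\<lambda>s. m1 s - m1' s) (\<lambda>s. m2 s - m2' s) n1 n2 r x y t)"
    by (simp add: half_line_integrand_diff[symmetric])
  then have "half_line_kernel m1 m2 n1 n2 r x y - half_line_kernel m1' m2' n1 n2 r x y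
      = half_line_kernel (\<lambda>s. m1 s - m1' s) (\<lambda>s. m2 s - m2' s) n1 n2 r x y"
    using D I' by (simp add: half_line_kernel_def)
  then show ?thesis using norm_half_line_kernel_le[OF dm n] by simp
next
  case False
  then have "?H = top" by (metis infinity_ennreal_def top.not_eq_extremum)
  then show ?thesis by (metis top_greatest)
qed

text \<open>Only the factors at x - t move with x, and they are uniformly continuous on the compact
  range of x - t. The cut-off and the integrable factors at t - y are the same for x and x'.\<close>

lemma half_line_kernel_equicontinuous:
  fixes m1 m2 n1 n2 :: "real \<Rightarrow> 'a::{real_normed_field, euclidean_space}"
  assumes cont: "continuous_on UNIV m1" "continuous_on UNIV m2"
    and B: "\<And>x. norm (m1 x) \<le> B" "\<And>x. norm (m2 x) \<le> B"
    and n: "integrable lborel n1" "integrable lborel n2"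
    and supp: "\<And>x. x \<notin> {-c..c} \<Longrightarrow> n1 x = 0" "\<And>x. x \<notin> {-c..c} \<Longrightarrow> n2 x = 0"
    and e: "e > 0"
  shows "\<exists>d>0. \<forall>x\<in>{-c..c}. \<forall>x'\<in>{-c..c}. \<forall>y\<in>{-c..c}. \<bar>x - x'\<bar> < d \<longrightarrow>
    norm (half_line_kernel m1 m2 n1 n2 r x y - half_line_kernel m1 m2 n1 n2 r x' y) \<le> e"
proof -
  have m [measurable]: "m1 \<in> borel_measurable borel" "m2 \<in> borel_measurable borel"
    using cont by (auto intro: borel_measurable_continuous_onI)
  note [measurable] = n[THEN borel_measurable_integrable, simplified]
  define L where "L = ((LINT s|lborel. norm (n1 s)) + (LINT s|lborel. norm (n2 s))) / norm r"
  have L: "L \<ge> 0" by (simp add: L_def integral_nonneg_AE)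
  define b where "b = e / (L + 1)"
  have b: "b > 0" using e L by (simp add: b_def)
  have unif: "\<exists>d>0. \<forall>u\<in>{-3*c..3*c}. \<forall>v\<in>{-3*c..3*c}. \<bar>u - v\<bar> < d \<longrightarrow> norm (m u - m v) \<le> b"
    if "continuous_on UNIV m" for m :: "real \<Rightarrow> 'a"
  proof -
    have "uniformly_continuous_on {-3*c..3*c} m"
      using continuous_on_subset[OF that] by (intro compact_uniformly_continuous) auto
    then show ?thesis
      using b unfolding uniformly_continuous_on_def dist_norm real_norm_def by (metis less_imp_le)
  qed
  obtain d1 where d1: "d1 > 0" "\<And>u v. u \<in> {-3*c..3*c} \<Longrightarrow> v \<in> {-3*c..3*c} \<Longrightarrow> \<bar>u - v\<bar> < d1 \<Longrightarrow>
      norm (m1 u - m1 v) \<le> b" using unif[OF cont(1)] by metis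
  obtain d2 where d2: "d2 > 0" "\<And>u v. u \<in> {-3*c..3*c} \<Longrightarrow> v \<in> {-3*c..3*c} \<Longrightarrow> \<bar>u - v\<bar> < d2 \<Longrightarrow>
      norm (m2 u - m2 v) \<le> b" using unif[OF cont(2)] by metis
  have "norm (half_line_kernel m1 m2 n1 n2 r x y - half_line_kernel m1 m2 n1 n2 r x' y) \<le> e"
    if x: "x \<in> {-c..c}" "x' \<in> {-c..c}" "y \<in> {-c..c}" and close: "\<bar>x - x'\<bar> < min d1 d2" for x x' y
  proof -
    have I: "integrable lborel (half_line_integrand m1 m2 n1 n2 r z y)" for z
      by (rule integrable_half_line_integrand[OF m n])
         (rule le_less_trans[OF half_line_majorant_bounded[OF m n B]], simp)
    have est: "norm (half_line_integrand m1 m2 n1 n2 r x y t - half_line_integrand m1 m2 n1 n2 r x' y t)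
        \<le> b / norm r * (norm (n1 (t - y)) + norm (n2 (t - y)))" for t
    proof (cases "t \<le> 0 \<and> t - y \<in> {-c..c}")
      case True
      \<comment> \<open>With y and t - y in [-c, c] one has |t| at most 2c, hence |x - t| at most
        3c.\<close>
      then have u: "x - t \<in> {-3*c..3*c}" "x' - t \<in> {-3*c..3*c}" using x by auto
      have w: "norm (m1 (x - t) - m1 (x' - t)) \<le> b" "norm (m2 (x - t) - m2 (x' - t)) \<le> b"
        using d1(2)[OF u] d2(2)[OF u] close by auto
      have "half_line_integrand m1 m2 n1 n2 r x y t - half_line_integrand m1 m2 n1 n2 r x' y t
          = (n1 (t - y) * (m2 (x - t) - m2 (x' - t)) - n2 (t - y) * (m1 (x - t) - m1 (x' - t))) / r"
        using True unfolding half_line_integrand_def scaleR_diff_right[symmetric] diff_divide_distrib[symmetric]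
        by (simp add: right_diff_distrib)
      also have "norm \<dots> \<le> (norm (n1 (t - y) * (m2 (x - t) - m2 (x' - t)))
          + norm (n2 (t - y) * (m1 (x - t) - m1 (x' - t)))) / norm r"
        unfolding norm_divide by (intro divide_right_mono norm_triangle_ineq4) auto
      also have "\<dots> \<le> (norm (n1 (t - y)) * b + norm (n2 (t - y)) * b) / norm r"
        unfolding norm_mult by (intro divide_right_mono add_mono mult_left_mono w) auto
      finally show ?thesis by (simp add: algebra_simps add_divide_distrib)
    next
      case False
      then have "half_line_integrand m1 m2 n1 n2 r z y t = 0" for z
        using supp[of "t - y"] by (auto simp: half_line_integrand_def)
      then show ?thesis using b by simp
    qed
    have shift: "integrable lborel (\<lambda>t. norm (n (t - y)))"
        "(LINT t|lborel. norm (n (t - y))) = (LINT t|lborel. norm (n t))"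
      if "integrable lborel n" for n :: "real \<Rightarrow> 'a"
      using lborel_integrable_real_affine[OF integrable_norm[OF that], of 1 "-y"]
        lborel_integral_real_affine[of 1 "\<lambda>t. norm (n t)" "-y"] by auto
    have "norm (half_line_kernel m1 m2 n1 n2 r x y - half_line_kernel m1 m2 n1 n2 r x' y)
        = norm (LINT t|lborel. half_line_integrand m1 m2 n1 n2 r x y t
          - half_line_integrand m1 m2 n1 n2 r x' y t)"
      using I by (simp add: half_line_kernel_def)
    also have "\<dots> \<le> (LINT t|lborel. b / norm r * (norm (n1 (t - y)) + norm (n2 (t - y))))"
      by (rule Bochner_Integration.integral_norm_bound_integral) (use I shift(1)[OF n(1)] shift(1)[OF n(2)] est in auto)
    also have "\<dots> = b * L"
      using shift[OF n(1)] shift[OF n(2)] by (simp add: L_def)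
    also have "\<dots> \<le> e" using e L by (simp add: b_def field_simps)
    finally show ?thesis .
  qed
  then show ?thesis using d1(1) d2(1) by (intro exI[of _ "min d1 d2"]) auto
qed

lemma half_line_kernel_approximable:
  fixes n1 n2 :: "real \<Rightarrow> 'a::{real_normed_field, euclidean_space}"
  assumes n: "integrable lborel n1" "integrable lborel n2"
    and supp: "\<And>x. x \<notin> {-c..c} \<Longrightarrow> n1 x = 0" "\<And>x. x \<notin> {-c..c} \<Longrightarrow> n2 x = 0"
    and e: "e > 0"
  shows "\<exists>K' C. case_prod K' \<in> borel_measurable (segment_measure c \<Otimes>\<^sub>M segment_measure c) \<and>
      Schur_bounded (segment_measure c) e (\<lambda>x y. half_line_kernel n1 n2 n1 n2 r x y - K' x y) \<and>
      (\<forall>x\<in>{-c..c}. \<forall>y\<in>{-c..c}. norm (K' x y) \<le> C) \<and>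
      (\<forall>e'>0. \<exists>d>0. \<forall>x\<in>{-c..c}. \<forall>x'\<in>{-c..c}. \<forall>y\<in>{-c..c}.
        \<bar>x - x'\<bar> < d \<longrightarrow> norm (K' x y - K' x' y) \<le> e')"
proof -
  note nm [measurable] = n[THEN borel_measurable_integrable, simplified]
  define L where "L = ((LINT s|lborel. norm (n1 s)) + (LINT s|lborel. norm (n2 s))) / norm r"
  have L: "L \<ge> 0" by (simp add: L_def integral_nonneg_AE)
  \<comment> \<open>An L^1 error below b in each of n1 and n2 gives a majorant of integral at most b
    * L, which does not exceed e.\<close>
  define b where "b = e / (L + 1)"
  have b: "b > 0" using e L by (simp add: b_def)
  obtain m1 where m1: "continuous_on UNIV m1" "bounded (range m1)" "integrable lborel m1"
      "(LINT x|lborel. norm (n1 x - m1 x)) < b" using integrable_approx_continuous[OF n(1) b] by blast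
  obtain m2 where m2: "continuous_on UNIV m2" "bounded (range m2)" "integrable lborel m2"
      "(LINT x|lborel. norm (n2 x - m2 x)) < b" using integrable_approx_continuous[OF n(2) b] by blast
  obtain B1 B2 where "\<And>x. norm (m1 x) \<le> B1" "\<And>x. norm (m2 x) \<le> B2"
    using m1(2) m2(2) unfolding bounded_iff by (metis rangeI)
  then have B: "norm (m1 x) \<le> max B1 B2" "norm (m2 x) \<le> max B1 B2" for x
    by (auto simp: le_max_iff_disj)
  have m [measurable]: "m1 \<in> borel_measurable borel" "m2 \<in> borel_measurable borel"
    using m1(1) m2(1) by (auto intro: borel_measurable_continuous_onI)
  define K' where "K' = half_line_kernel m1 m2 n1 n2 r"
  have id [measurable]: "(\<lambda>x. x) \<in> segment_measure c \<rightarrow>\<^sub>M borel"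
    by (intro measurable_restrict_space1 measurable_completion) simp
  have "case_prod K' \<in> borel_measurable (segment_measure c \<Otimes>\<^sub>M segment_measure c)"
    unfolding K'_def case_prod_beta'
    by (intro borel_measurable_half_line_kernel m nm measurable_compose[OF measurable_fst id]
        measurable_compose[OF measurable_snd id])
  moreover have "Schur_bounded (segment_measure c) e (\<lambda>x y. half_line_kernel n1 n2 n1 n2 r x y - K' x y)"
    unfolding K'_def
  proof (rule Schur_bounded_convolution)
    show "ennreal (norm (half_line_kernel n1 n2 n1 n2 r x y - half_line_kernel m1 m2 n1 n2 r x y))
        \<le> half_line_majorant (\<lambda>s. n1 s - m1 s) (\<lambda>s. n2 s - m2 s) n1 n2 r (x - y)" for x y
      by (rule half_line_kernel_diff_le[OF nm m n B])
    show "{-c..c} \<in> sets lebesgue" by simp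
    show "half_line_majorant (\<lambda>s. n1 s - m1 s) (\<lambda>s. n2 s - m2 s) n1 n2 r \<in> borel_measurable borel"
      by measurable
    have "(\<integral>\<^sup>+w. half_line_majorant (\<lambda>s. n1 s - m1 s) (\<lambda>s. n2 s - m2 s) n1 n2 r w \<partial>lborel)
      = ennreal (((LINT s|lborel. norm (n1 s)) * (LINT s|lborel. norm (n2 s - m2 s))
        + (LINT s|lborel. norm (n2 s)) * (LINT s|lborel. norm (n1 s - m1 s))) / norm r)"
      using n m1 m2 by (intro nn_integral_half_line_majorant) auto
    also have "\<dots> \<le> ennreal (((LINT s|lborel. norm (n1 s)) * b + (LINT s|lborel. norm (n2 s)) * b) / norm r)"
      using m1(4) m2(4)
      by (intro ennreal_leI divide_right_mono add_mono mult_left_mono) (auto simp: integral_nonneg_AE)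
    also have "\<dots> = ennreal (b * L)" by (simp add: L_def algebra_simps)
    also have "\<dots> \<le> ennreal e" using e L by (intro ennreal_leI) (simp add: b_def field_simps)
    finally show "(\<integral>\<^sup>+w. half_line_majorant (\<lambda>s. n1 s - m1 s) (\<lambda>s. n2 s - m2 s) n1 n2 r w \<partial>lborel) \<le> ennreal e" .
  qed
  moreover have "norm (K' x y) \<le> max B1 B2 * L" for x y
  proof -
    have "ennreal (norm (K' x y)) \<le> ennreal (max B1 B2 * L)"
      using order_trans[OF norm_half_line_kernel_le[OF m n] half_line_majorant_bounded[OF m n B]]
      by (simp add: K'_def L_def)
    moreover have "max B1 B2 \<ge> 0" using B(1)[of 0] by (auto intro: order_trans[OF norm_ge_zero])
    ultimately show ?thesis using L by (subst (asm) ennreal_le_iff) auto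
  qed
  moreover have "\<exists>d>0. \<forall>x\<in>{-c..c}. \<forall>x'\<in>{-c..c}. \<forall>y\<in>{-c..c}.
      \<bar>x - x'\<bar> < d \<longrightarrow> norm (K' x y - K' x' y) \<le> e'" if "e' > 0" for e'
    unfolding K'_def
    by (rule half_line_kernel_equicontinuous[OF m1(1) m2(1) B n supp that])
  ultimately show ?thesis by blast
qed

section \<open>The operator \<open>B\<close>\<close>

lemma Schur_bounded_cong:
  assumes "\<And>x y. x \<in> space M \<Longrightarrow> y \<in> space M \<Longrightarrow> D x y = D' x y"
  shows "Schur_bounded M h D \<longleftrightarrow> Schur_bounded M h D'"
  using assms by (simp add: Schur_bounded_def cong: ball_cong)

text \<open>Under \<open>s = x + y - 2 t\<close> the upper limit \<open>2 c - \<bar>x - y\<bar>\<close> becomes the lower limit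
  \<open>max x y - c\<close>, below which one factor of each product vanishes.\<close>

lemma
  fixes N1 N2 n1 n2 :: "real \<Rightarrow> 'a::{real_normed_field, euclidean_space}"
  assumes n [measurable]: "n1 \<in> borel_measurable borel" "n2 \<in> borel_measurable borel"
    and supp: "\<And>x. x \<notin> {-c..c} \<Longrightarrow> n1 x = 0" "\<And>x. x \<notin> {-c..c} \<Longrightarrow> n2 x = 0"
    and eq: "AE x in lborel. x \<in> {-c..c} \<longrightarrow> n1 x = N1 x" "AE x in lborel. x \<in> {-c..c} \<longrightarrow> n2 x = N2 x"
    and r: "r = (LINT t|segment_measure c. N1 t)"
    and x: "x \<in> {-c..c}" and y: "y \<in> {-c..c}"
  shows integrable_Phi_integrand_iff:
      "integrable (lebesgue_on {x + y..2 * c - \<bar>x - y\<bar>}) (Phi_integrand c N1 N2 x y)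
        \<longleftrightarrow> integrable lborel (half_line_integrand n1 n2 n1 n2 r x y)" (is "?int")
    and Phi_kernel_eq_half_line_kernel:
      "Phi_kernel c N1 N2 x y = half_line_kernel n1 n2 n1 n2 r x y" (is "?eq")
proof -
  define I where "I = {x + y..2 * c - \<bar>x - y\<bar>}"
  define f where "f s = indicator I s *\<^sub>R Phi_integrand c N1 N2 x y s" for s
  define g where "g s = half_line_integrand n1 n2 n1 n2 r x y ((x + y) / 2 + (-1/2) * s)" for s
  have g [measurable]: "g \<in> borel_measurable borel" unfolding g_def by measurable
  have I: "I \<inter> space lebesgue \<in> sets lebesgue" by (simp add: I_def)
  have "AE x in lborel. x \<in> {-c..c} \<longrightarrow> n1 x = N1 x \<and> n2 x = N2 x"
    using eq by eventually_elim auto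
  \<comment> \<open>One Borel null set outside which both representatives agree with
    \<open>N1\<close> and \<open>N2\<close> on the segment; its preimages under the two affine maps
    in s are null as well.\<close>
  then obtain Z where Z: "Z \<in> null_sets lborel"
      and Zsub: "{x \<in> space lborel. \<not> (x \<in> {-c..c} \<longrightarrow> n1 x = N1 x \<and> n2 x = N2 x)} \<subseteq> Z"
    unfolding eventually_ae_filter by blast
  have ZD: "n1 x = N1 x \<and> n2 x = N2 x" if "x \<notin> Z" "x \<in> {-c..c}" for x
    using Zsub that by auto
  have [measurable]: "Z \<in> sets borel" using Z by auto
  have notin: "AE s in lborel. a + b * s \<notin> Z" if "b \<noteq> 0" for a b :: real
    by (rule AE_borel_affine[OF that _ AE_not_in[OF Z]]) measurable
  have "AE s in lborel. (x - y) / 2 + - 1 / 2 * s \<notin> Z" "AE s in lborel. (x - y) / 2 + 1 / 2 * s \<notin> Z"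
    by (rule notin; simp)+
  then have "AE s in lborel. g s = f s"
  proof eventually_elim
    case (elim s)
    define t where "t = (x + y) / 2 + (-1/2) * s"
    have ts: "t - y = (x - y) / 2 + - 1 / 2 * s" "x - t = (x - y) / 2 + 1 / 2 * s"
      by (auto simp: t_def field_simps)
    have args: "(s + x - y) / 2 = x - t" "- ((s - x + y) / 2) = t - y"
      by (auto simp: t_def field_simps)
    show "g s = f s"
    proof (cases "s \<in> I")
      case True
      then have t: "t \<le> 0" "x - t \<in> {-c..c}" "t - y \<in> {-c..c}"
        using x y by (auto simp: I_def t_def abs_if field_simps split: if_splits)
      have "x - t \<notin> Z" "t - y \<notin> Z" using elim by (simp_all only: ts not_False_eq_True)
      then have v: "n1 (x - t) = N1 (x - t)" "n2 (x - t) = N2 (x - t)"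
          "n1 (t - y) = N1 (t - y)" "n2 (t - y) = N2 (t - y)"
        using ZD t by auto
      have "g s = (n1 (t - y) * n2 (x - t) - n2 (t - y) * n1 (x - t)) / r"
        unfolding g_def t_def[symmetric] half_line_integrand_def using t(1) by simp
      moreover have "f s = (N1 (t - y) * N2 (x - t) - N2 (t - y) * N1 (x - t)) / r"
        unfolding f_def Phi_integrand_def q_kernel_def args r using True by simp
      ultimately show ?thesis by (simp only: v)
    next
      case False
      \<comment> \<open>Below the lower limit t is positive. Above the upper limit x - t exceeds c
        if \<open>x \<ge> y\<close>, and t - y lies below -c otherwise.\<close>
      then have "t > 0 \<or> x - t \<notin> {-c..c} \<or> t - y \<notin> {-c..c}"
        by (auto simp: I_def t_def abs_if field_simps split: if_splits)
      then have "half_line_integrand n1 n2 n1 n2 r x y t = 0"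
        using supp[of "x - t"] supp[of "t - y"] by (auto simp: half_line_integrand_def)
      then show ?thesis unfolding f_def g_def t_def[symmetric] using False by simp
    qed
  qed
  then have AE: "AE s in lebesgue. g s = f s" by (rule AE_completion)
  have gL: "g \<in> borel_measurable lebesgue" using g by (intro measurable_completion) simp
  \<comment> \<open>Completeness of \<open>lebesgue\<close>: f agrees almost everywhere with the
    Borel function g and so is measurable.\<close>
  have fL: "f \<in> borel_measurable lebesgue" by (rule borel_measurable_AE[OF gL AE])
  have "integrable (lebesgue_on I) (Phi_integrand c N1 N2 x y) \<longleftrightarrow> integrable lebesgue f"
    unfolding f_def by (rule integrable_restrict_space[OF I])
  also have "\<dots> \<longleftrightarrow> integrable lebesgue g"
    using AE by (intro integrable_cong_AE fL gL) (auto simp: eq_commute)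
  also have "\<dots> \<longleftrightarrow> integrable lborel g" using g by (intro integrable_completion) simp
  also have "\<dots> \<longleftrightarrow> integrable lborel (half_line_integrand n1 n2 n1 n2 r x y)"
    unfolding g_def by (intro lborel_integrable_real_affine_iff) simp
  finally show ?int by (simp add: I_def)
  have "(LINT s|lebesgue_on I. Phi_integrand c N1 N2 x y s) = (LINT s|lebesgue. f s)"
    unfolding f_def by (rule integral_restrict_space[OF I])
  also have "\<dots> = (LINT s|lebesgue. g s)"
    using AE by (intro integral_cong_AE fL gL) (auto simp: eq_commute)
  also have "\<dots> = (LINT s|lborel. g s)" using g by (intro integral_completion) simp
  \<comment> \<open>The factor 1/2 in \<open>Phi_kernel\<close> is the Jacobian of s -> (x + y)/2 -
    s/2.\<close>
  finally show ?eq
    unfolding half_line_kernel_def Phi_kernel_def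
    by (subst lborel_integral_real_affine[of "-1/2" _ "(x + y) / 2"]) (simp_all add: I_def g_def)
qed

theorem proposition8p2:
  fixes A c p\<^sub>0 :: real
    and k :: "real \<Rightarrow> real"
    and N1 N2 :: "real \<Rightarrow> 'a::{real_normed_field, euclidean_space}"
  assumes "c > 0"
    and "A \<ge> 0"
    and "\<And>M. M > 0 \<Longrightarrow> integrable (lebesgue_on {-M..M}) k"
    and "p\<^sub>0 > 1"
    and "N1 \<in> Lp_fun (segment_measure c) p\<^sub>0"
    and "N2 \<in> Lp_fun (segment_measure c) p\<^sub>0"
    and "AE x in segment_measure c. S_op A k c N1 x = 1"
    and "AE x in segment_measure c. S_op A k c N2 x = of_real x"
    and "(LINT x|segment_measure c. N1 x) \<noteq> 0"
  shows "\<forall>p\<ge>1. B_op_converges c N1 N2 p \<and>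
           Lp_compact_operator (segment_measure c) p (B_op c N1 N2)"
proof (intro allI impI)
  fix p :: real assume p: "p \<ge> 1"
  define M where "M = segment_measure c"
  have sp: "space M = {-c..c}" by (simp add: M_def)
  have fin: "finite_measure M" unfolding M_def by (rule finite_measure_lebesgue_on) simp
  define r where "r = (LINT t|segment_measure c. N1 t)"
  have cb: "{-c..c} \<in> sets borel" by simp
  \<comment> \<open>On the segment, of finite measure, membership in L^p for the exponent
    \<open>p\<^sub>0\<close> gives integrability; the Borel representative extended by 0 is then
    integrable on the whole line.\<close>
  have rep: "\<exists>n. integrable lborel n \<and> (\<forall>x. x \<notin> {-c..c} \<longrightarrow> n x = 0) \<and>
      (AE x in lborel. x \<in> {-c..c} \<longrightarrow> n x = N x)"
    if N: "N \<in> Lp_fun (segment_measure c) p\<^sub>0" for N :: "real \<Rightarrow> 'a"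
  proof -
    have int: "integrable M N" using Lp_fun_integrable[OF fin _ N[folded M_def]] assms(4) by simp
    obtain n where n: "n \<in> borel_measurable borel" "\<And>x. x \<notin> {-c..c} \<Longrightarrow> n x = 0"
        "AE x in lborel. x \<in> {-c..c} \<longrightarrow> n x = N x"
      by (rule lebesgue_on_ex_borel_measurable[OF Lp_fun_measurable[OF N] cb]) (rule that)
    have nL: "n \<in> borel_measurable lebesgue" using n(1) by (intro measurable_completion) simp
    have intL: "integrable lebesgue (\<lambda>x. indicator {-c..c} x *\<^sub>R N x)"
      using int unfolding M_def by (subst (asm) integrable_restrict_space) auto
    have "AE x in lborel. indicator {-c..c} x *\<^sub>R N x = n x"
      using n(3) by eventually_elim (use n(2) in \<open>auto simp: indicator_def\<close>)
    then have "integrable lebesgue n"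
      using intL integrable_cong_AE[OF borel_measurable_integrable[OF intL] nL AE_completion] by blast
    then have "integrable lborel n" using n(1) by (subst (asm) integrable_completion) auto
    then show ?thesis using n by blast
  qed
  obtain n1 where n1: "integrable lborel n1" "\<And>x. x \<notin> {-c..c} \<Longrightarrow> n1 x = 0"
      "AE x in lborel. x \<in> {-c..c} \<longrightarrow> n1 x = N1 x" using rep[OF assms(5)] by blast
  obtain n2 where n2: "integrable lborel n2" "\<And>x. x \<notin> {-c..c} \<Longrightarrow> n2 x = 0"
      "AE x in lborel. x \<in> {-c..c} \<longrightarrow> n2 x = N2 x" using rep[OF assms(6)] by blast
  have nm: "n1 \<in> borel_measurable borel" "n2 \<in> borel_measurable borel"
    using n1(1) n2(1) by (auto dest: borel_measurable_integrable)
  note Phi = integrable_Phi_integrand_iff[OF nm n1(2) n2(2) n1(3) n2(3) r_def]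
    Phi_kernel_eq_half_line_kernel[OF nm n1(2) n2(2) n1(3) n2(3) r_def]
  define K where "K = half_line_kernel n1 n2 n1 n2 r"
  have Phi_K: "Phi_kernel c N1 N2 x y = K x y" if "x \<in> {-c..c}" "y \<in> {-c..c}" for x y
    unfolding K_def by (rule Phi(2)[OF _ _ that])
  have id: "(\<lambda>x. x) \<in> M \<rightarrow>\<^sub>M borel"
    unfolding M_def by (intro measurable_restrict_space1 measurable_completion) simp
  have "case_prod K \<in> borel_measurable (M \<Otimes>\<^sub>M M)"
    unfolding K_def case_prod_beta'
    by (intro borel_measurable_half_line_kernel nm measurable_compose[OF measurable_fst id]
        measurable_compose[OF measurable_snd id])
  moreover have "case_prod (Phi_kernel c N1 N2) \<in> borel_measurable (M \<Otimes>\<^sub>M M)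
      \<longleftrightarrow> case_prod K \<in> borel_measurable (M \<Otimes>\<^sub>M M)"
    by (rule measurable_cong) (auto simp: space_pair_measure sp Phi_K)
  ultimately have meas: "case_prod (Phi_kernel c N1 N2) \<in> borel_measurable (M \<Otimes>\<^sub>M M)" by simp
  have S_K: "Schur_bounded M e (\<lambda>x y. Phi_kernel c N1 N2 x y - K' x y)
      \<longleftrightarrow> Schur_bounded M e (\<lambda>x y. K x y - K' x y)" for e K'
    by (rule Schur_bounded_cong) (simp add: sp Phi_K)
  have approx: "\<exists>K' C. case_prod K' \<in> borel_measurable (M \<Otimes>\<^sub>M M) \<and>
      Schur_bounded M e (\<lambda>x y. Phi_kernel c N1 N2 x y - K' x y) \<and>
      (\<forall>x\<in>{-c..c}. \<forall>y\<in>{-c..c}. norm (K' x y) \<le> C) \<and>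
      (\<forall>e'>0. \<exists>d>0. \<forall>x\<in>{-c..c}. \<forall>x'\<in>{-c..c}. \<forall>y\<in>{-c..c}.
        \<bar>x - x'\<bar> < d \<longrightarrow> norm (K' x y - K' x' y) \<le> e')" if "e > 0" for e
    unfolding S_K unfolding K_def M_def
    by (rule half_line_kernel_approximable[OF n1(1) n2(1) n1(2) n2(2) that])
  note compact = approximable_kernel_integrable[OF assms(1) p meas[unfolded M_def] approx[unfolded M_def]]
    approximable_kernel_compact[OF assms(1) p meas[unfolded M_def] approx[unfolded M_def]]
  have B: "B_op c N1 N2 = integral_operator M (Phi_kernel c N1 N2)"
    by (auto simp: fun_eq_iff B_op_def integral_operator_def M_def)
  \<comment> \<open>Convergence of the integral defining the kernel: the majorant has a finite
    integral, so it is finite at almost every w. For each fixed x this pulls back along y -> x - y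
    to almost every y.\<close>
  have "(\<integral>\<^sup>+w. half_line_majorant n1 n2 n1 n2 r w \<partial>lborel) \<noteq> \<infinity>"
    by (subst nn_integral_half_line_majorant[OF nm n1(1) n2(1) n1(1) n2(1)]) simp
  then have "AE w in lborel. half_line_majorant n1 n2 n1 n2 r w \<noteq> \<infinity>"
    using borel_measurable_half_line_majorant[OF nm nm measurable_ident]
    by (intro nn_integral_noteq_infinite) auto
  then have fin_w: "AE y in lborel. half_line_majorant n1 n2 n1 n2 r (x + (-1) * y) \<noteq> \<infinity>" for x
    using borel_measurable_half_line_majorant[OF nm nm measurable_ident, of r]
    by (intro AE_borel_affine[where P = "\<lambda>w. half_line_majorant n1 n2 n1 n2 r w \<noteq> \<infinity>"]) auto
  have "AE y in M. integrable (lebesgue_on {x + y..2 * c - \<bar>x - y\<bar>}) (Phi_integrand c N1 N2 x y)"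
    if x: "x \<in> {-c..c}" for x
  proof -
    have "AE y in lebesgue. y \<in> {-c..c} \<longrightarrow>
        integrable (lebesgue_on {x + y..2 * c - \<bar>x - y\<bar>}) (Phi_integrand c N1 N2 x y)"
      using AE_completion[OF fin_w[of x]]
    proof eventually_elim
      case (elim y)
      then have "integrable lborel (half_line_integrand n1 n2 n1 n2 r x y)"
        by (intro integrable_half_line_integrand[OF nm n1(1) n2(1)]) (simp add: top.not_eq_extremum)
      then show ?case using Phi(1)[OF _ _ x, of y] by blast
    qed
    then show ?thesis unfolding M_def by (subst AE_restrict_space_iff) auto
  qed
  then have "AE x in M. AE y in M.
      integrable (lebesgue_on {x + y..2 * c - \<bar>x - y\<bar>}) (Phi_integrand c N1 N2 x y)"
    by (rule AE_I2) (simp only: sp)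
  then show "B_op_converges c N1 N2 p \<and> Lp_compact_operator (segment_measure c) p (B_op c N1 N2)"
    using compact unfolding B_op_converges_def B M_def by blast
qed

end
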